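(* Let $p\in[1,+\infty)$ and let $p'\in(0,p]$. Let $(Y_n)_{n\ge0}$ be an $\mathbb{R}^q$-valued homogeneous Markov chain with transition $(P(y,dz))_{y\in\mathbb{R}^q}$, and let $\nu$ be a probability measure on $\mathbb{R}^q$. Assume that $(Y_n)_{n\ge0}$ is $\mathbb{P}_\nu$-ergodic and that $P(y,dz)=g(y,z)\,\nu(dz)$ for every $y\in\mathbb{R}^q$, where $g:(\mathbb{R}^q)^2\to\mathbb{R}_+$ is such that, for $\nu$-almost every $z$, $g(y,z)>0$ for all $y\in\mathbb{R}^q$. Then $\nu$ is the unique invariant distribution of $P$, and for every sequence $(\varepsilon_n)_{n\ge0}$ of nonnegative numbers with $\varepsilon_n\to0$ and $\liminf_n n\varepsilon_n>0$, $$\forall y\in\mathbb{R}^q,\quad g(y,\cdot)\in L^{\frac{p}{p-p'}}(\nu)\ \Longrightarrow\ \mathcal{V}_{\varepsilon_n,p'}(\mathbb{P}_y)\supset\mathcal{V}_{\varepsilon_n,p}(\mathbb{P}_\nu).$$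
   Context: The chain is the canonical process on $((\mathbb{R}^q)^{\mathbb{N}},\mathcal{B}or(\mathbb{R}^q)^{\otimes\mathbb{N}})$; $\mathbb{P}_\mu$ denotes the law of the chain with initial distribution $\mu$, and $\mathbb{P}_y=\mathbb{P}_{\delta_y}$. $(Y_n)$ is $\mathbb{P}_\nu$-ergodic if for every bounded Borel $f:\mathbb{R}^q\to\mathbb{R}$, $\frac1n\sum_{k=0}^{n-1}f(Y_k)\to\int f\,d\nu$ $\mathbb{P}_\nu$-a.s. (this implies $\nu P=\nu$). For $r\in(0,\infty)$ and a probability measure $\mathbb{Q}\in\{\mathbb{P}_\nu,\mathbb{P}_y\}$, $\mathcal{V}_{\varepsilon_n,r}(\mathbb{Q})$ is the class of Borel functions $f:\mathbb{R}^q\to\mathbb{R}$ in $L^{r}(\nu)$ such that $\frac1n\sum_{k=0}^{n-1}f(Y_k)-\int f\,d\nu=O(\varepsilon_n)$ both $\mathbb{Q}$-a.s. (with a possibly random constant) and in $L^r(\mathbb{Q})$ (i.e. $\big(\mathbb{E}_{\mathbb{Q}}|\cdot|^r\big)^{1/r}$ of the left side is $O(\varepsilon_n)$), where $\int f\,d\nu$ is meant to be well defined. If $p'=p$, $\frac{p}{p-p'}=+\infty$. *)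

theory Defs
  imports "HOL-Probability.Probability"
begin

section \<open>Markov chains on the canonical path space\<close>

definition transition_kernel :: "('a::topological_space \<Rightarrow> 'a measure) \<Rightarrow> bool" where
  "transition_kernel P \<longleftrightarrow> P \<in> borel \<rightarrow>\<^sub>M prob_algebra borel"

definition invariant_distribution :: "('a::topological_space \<Rightarrow> 'a measure) \<Rightarrow> 'a measure \<Rightarrow> bool" where
  "invariant_distribution P \<mu> \<longleftrightarrow> prob_space \<mu> \<and> sets \<mu> = sets borel \<and> \<mu> \<bind> P = \<mu>"

text \<open>
  The conditional law of the coordinate \<^term>\<open>n\<close> given the coordinates \<^term>\<open>0\<close> to \<^term>\<open>n - 1\<close>.
  The law of the chain is the extension that the Ionescu Tulcea theorem provides for
  this sequence of kernels. The chain itself is the coordinate process: \<open>Y\<^sub>n \<omega> = \<omega> n\<close>.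
\<close>

definition chain_step ::
    "('a::topological_space \<Rightarrow> 'a measure) \<Rightarrow> 'a measure \<Rightarrow> nat \<Rightarrow> (nat \<Rightarrow> 'a) \<Rightarrow> 'a measure" where
  "chain_step P \<mu> n \<omega> = (case n of 0 \<Rightarrow> \<mu> | Suc m \<Rightarrow> P (\<omega> m))"

definition chain_law ::
    "('a::topological_space \<Rightarrow> 'a measure) \<Rightarrow> 'a measure \<Rightarrow> (nat \<Rightarrow> 'a) measure" where
  "chain_law P \<mu> =
     projective_family.lim UNIV (Ionescu_Tulcea.CI (chain_step P \<mu>) (\<lambda>_. borel)) (\<lambda>_. borel)"

lemma Ionescu_Tulcea_chain_step:
  assumes P: "transition_kernel P" and \<mu>: "prob_space \<mu>" "sets \<mu> = sets borel"
  shows "Ionescu_Tulcea (chain_step P \<mu>) (\<lambda>_. borel)"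
proof (rule Ionescu_Tulcea.intro)
  have PP: "P \<in> borel \<rightarrow>\<^sub>M subprob_algebra borel"
    using P by (simp add: transition_kernel_def measurable_prob_algebraD)
  show "chain_step P \<mu> i \<in> PiM {0..<i} (\<lambda>_. borel) \<rightarrow>\<^sub>M subprob_algebra borel" for i
  proof (cases i)
    case 0
    have "\<mu> \<in> space (subprob_algebra borel)"
      using \<mu> by (simp add: space_subprob_algebra prob_space_imp_subprob_space)
    with 0 show ?thesis by (simp add: chain_step_def[abs_def])
  next
    case (Suc m)
    have "(\<lambda>\<omega>. P (\<omega> m)) \<in> PiM {0..<i} (\<lambda>_. borel) \<rightarrow>\<^sub>M subprob_algebra borel"
      using Suc by (intro measurable_compose[OF _ PP] measurable_component_singleton) auto
    with Suc show ?thesis by (simp add: chain_step_def[abs_def])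
  qed
  have PX: "prob_space (P x)" for x
    using measurable_space[OF P[unfolded transition_kernel_def], of x] by (simp add: space_prob_algebra)
  show "prob_space (chain_step P \<mu> i x)" if "x \<in> space (PiM {0..<i} (\<lambda>_. borel))" for i and x :: "nat \<Rightarrow> 'a"
    by (cases i) (simp_all add: chain_step_def \<mu> PX)
qed

context
  fixes P :: "'a::topological_space \<Rightarrow> 'a measure" and \<mu> :: "'a measure"
  assumes P: "transition_kernel P" and \<mu>: "prob_space \<mu>" "sets \<mu> = sets borel"
begin

interpretation IT: Ionescu_Tulcea "chain_step P \<mu>" "\<lambda>_. borel"
  by (rule Ionescu_Tulcea_chain_step[OF P \<mu>])

lemma sets_chain_law: "sets (chain_law P \<mu>) = sets (PiM UNIV (\<lambda>_. borel))"
  by (simp add: chain_law_def)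

lemma prob_space_chain_law: "prob_space (chain_law P \<mu>)"
proof (rule prob_spaceI)
  have "emeasure (chain_law P \<mu>) (IT.PF.emb UNIV {} (space (PiM {} (\<lambda>_. borel)))) =
      emeasure (IT.CI {}) (space (PiM {} (\<lambda>_. borel)))"
    unfolding chain_law_def by (rule IT.lim) (rule finite.emptyI, rule sets.top)
  also have "\<dots> = 1"
    using prob_space.emeasure_space_1[OF IT.PF.prob_space_P[of "{}"]] IT.PF.space_P[of "{}"] by simp
  also have "IT.PF.emb UNIV {} (space (PiM {} (\<lambda>_. borel))) = space (chain_law P \<mu>)"
    by (auto simp: chain_law_def space_PiM prod_emb_def restrict_def)
  finally show "emeasure (chain_law P \<mu>) (space (chain_law P \<mu>)) = 1" .
qed

lemma distr_chain_law_prefix: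
  "distr (chain_law P \<mu>) (PiM {0..<n} (\<lambda>_. borel)) (\<lambda>\<omega>. restrict \<omega> {0..<n}) =
     IT.C 0 n (\<lambda>_. undefined)"
proof -
  have "IT.up_to {0..<n} = n"
    unfolding IT.up_to_def by (rule Least_equality) (auto simp: not_less[symmetric])
  then have *: "IT.C 0 n (\<lambda>_. undefined) = IT.CI {0..<n}"
    unfolding IT.CI_def using IT.distr_C[of n n "\<lambda>_. undefined" 0] by simp
  show ?thesis
    unfolding * chain_law_def by (rule IT.distr_lim) simp
qed

end


section \<open>Ergodicity and the rate classes\<close>

definition ergodic_chain :: "('a::topological_space \<Rightarrow> 'a measure) \<Rightarrow> 'a measure \<Rightarrow> bool" where
  "ergodic_chain P \<nu> \<longleftrightarrow>
     (\<forall>f \<in> borel_measurable borel. bounded (range f) \<longrightarrow>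
       (AE \<omega> in chain_law P \<nu>.
          (\<lambda>n. (\<Sum>k<n. f (\<omega> k)) / real n) \<longlonglongrightarrow> (\<integral>x. f x \<partial>\<nu> :: real)))"

text \<open>
  Real functions in \<open>L\<^sup>r\<close>, for an exponent \<open>0 < r \<le> \<infinity>\<close>.
\<close>

definition Lr_space :: "ereal \<Rightarrow> 'b measure \<Rightarrow> ('b \<Rightarrow> real) set" where
  "Lr_space r M = {f \<in> borel_measurable M.
     if r = \<infinity> then (\<exists>C. AE x in M. \<bar>f x\<bar> \<le> C)
     else integrable M (\<lambda>x. \<bar>f x\<bar> powr real_of_ereal r)}"

definition ergodic_error :: "'a measure \<Rightarrow> ('a \<Rightarrow> real) \<Rightarrow> nat \<Rightarrow> (nat \<Rightarrow> 'a) \<Rightarrow> real" where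
  "ergodic_error \<nu> f n \<omega> = (\<Sum>k<n. f (\<omega> k)) / real n - (\<integral>x. f x \<partial>\<nu>)"

text \<open>
  For \<open>r < 1\<close> membership in \<open>L\<^sup>r(\<nu>)\<close> does not give a meaning to \<open>\<integral>f d\<nu>\<close>, so
  integrability is required separately. An integral equal to \<open>\<infinity>\<close> or \<open>-\<infinity>\<close> need
  not be allowed for: no error would then be \<open>O(\<epsilon>\<^sub>n)\<close>.
  An \<open>L\<^sup>r\<close> norm that is \<open>O(\<epsilon>\<^sub>n)\<close> is finite for all large \<open>n\<close>. This has to be
  said explicitly, since the Bochner integral of a non-integrable function is 0.
\<close>

definition rate_class ::
    "(nat \<Rightarrow> real) \<Rightarrow> real \<Rightarrow> 'a::topological_space measure \<Rightarrow> (nat \<Rightarrow> 'a) measure \<Rightarrow> ('a \<Rightarrow> real) set" where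
  "rate_class \<epsilon> r \<nu> Q = {f \<in> borel_measurable borel.
     f \<in> Lr_space (ereal r) \<nu> \<and> integrable \<nu> f \<and>
     (AE \<omega> in Q. (\<lambda>n. ergodic_error \<nu> f n \<omega>) \<in> O(\<epsilon>)) \<and>
     (\<forall>\<^sub>F n in sequentially. ergodic_error \<nu> f n \<in> Lr_space (ereal r) Q) \<and>
     (\<lambda>n. (\<integral>\<omega>. \<bar>ergodic_error \<nu> f n \<omega>\<bar> powr r \<partial>Q) powr (1 / r)) \<in> O(\<epsilon>)}"

end

theory Submission
  imports Defs
begin

text \<open>
  Everything rests on two facts about the law of the chain. The shifted path \<open>(Y\<^sub>1, Y\<^sub>2, \<dots>)\<close> of
  the chain with initial law \<open>\<mu>\<close> is a chain with initial law \<open>\<mu>P\<close> (\<open>distr_chain_law_shift\<close>),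
  and a density \<open>h\<close> of the initial law becomes the density \<open>h(Y\<^sub>0)\<close> of the law of the chain
  (\<open>chain_law_density\<close>). Hence, when \<open>P(y) = g(y,\<cdot>)\<nu>\<close>, the path of the chain from \<open>y\<close>, after
  one step, has law \<open>g(y, Y\<^sub>0) d\<bbbP>\<^sub>\<nu>\<close>.

  Invariance of \<open>\<nu>\<close> follows from ergodicity by comparing the Cesaro means of \<open>E f(Y\<^sub>k)\<close> and
  \<open>E f(Y\<^sub>k\<^sub>+\<^sub>1)\<close> (\<open>invariant_distribution_ergodic\<close>). Any invariant law is absolutely
  continuous with respect to \<open>\<nu>\<close>, so its chain has the same almost sure limits of time averages;
  taking expectations identifies it with \<open>\<nu>\<close> (\<open>invariant_distribution_unique\<close>).

  For the rates, write \<open>f\<^sub>0 = f - \<integral> f d\<nu>\<close>. The error at time \<open>n\<close> is \<open>f\<^sub>0(Y\<^sub>0)/n\<close> plus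
  \<open>W\<^sub>n = (f\<^sub>0(Y\<^sub>1) + \<cdots> + f\<^sub>0(Y\<^sub>n\<^sub>-\<^sub>1))/n\<close>, and \<open>1/n = O(\<epsilon>\<^sub>n)\<close> because \<open>n\<epsilon>\<^sub>n\<close> is
  bounded away from 0. So under \<open>\<bbbP>\<^sub>\<nu>\<close> the term \<open>W\<^sub>n\<close> inherits the rate of the error. It is a
  function of the shifted path, whose law is \<open>\<bbbP>\<^sub>\<nu>\<close> under \<open>\<bbbP>\<^sub>\<nu>\<close> and \<open>g(y, Y\<^sub>0) d\<bbbP>\<^sub>\<nu>\<close>
  under \<open>\<bbbP>\<^sub>y\<close>. The almost sure rate passes from the first law to the second by absolute
  continuity. The \<open>L\<^sup>p\<close> rate becomes an \<open>L\<^sup>p\<^sup>'\<close> rate by Young's inequality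
  \<open>a b\<^sup>p\<^sup>' \<le> a\<^sup>p\<^sup>/\<^sup>(\<^sup>p\<^sup>-\<^sup>p\<^sup>'\<^sup>) + b\<^sup>p\<close> with \<open>a = g(y, Y\<^sub>0)\<close> and \<open>b = |W\<^sub>n|/\<epsilon>\<^sub>n\<close>.
\<close>

section \<open>Expectations of products along the chain\<close>

text \<open>
  Finite products \<open>f\<^sub>0(Y\<^sub>0) \<cdots> f\<^sub>n(Y\<^sub>n)\<close> determine a law on path space. Their expectation under
  the chain is computed by integrating out the last coordinate first, and \<open>path_weight\<close> is
  this backward integral, conditional on the starting point. Shifting a path prepends a
  factor 1, and reweighting the initial law changes only the first factor: in this form both
  operations are read off from the recursion.
\<close>

primrec path_weight ::
    "('a \<Rightarrow> 'a measure) \<Rightarrow> ('a \<Rightarrow> ennreal) list \<Rightarrow> 'a \<Rightarrow> ennreal" where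
  "path_weight P [] x = 1"
| "path_weight P (f # fs) x = f x * (\<integral>\<^sup>+z. path_weight P fs z \<partial>P x)"

lemma path_weight_Nil: "path_weight P [] = (\<lambda>_. 1)"
  by (simp add: fun_eq_iff)

lemma path_weight_Cons: "path_weight P (f # fs) = (\<lambda>x. f x * (\<integral>\<^sup>+z. path_weight P fs z \<partial>P x))"
  by (simp add: fun_eq_iff)

abbreviation paths :: "(nat \<Rightarrow> 'a::topological_space) measure" where
  "paths \<equiv> PiM UNIV (\<lambda>_. borel)"

context
  fixes P :: "'a::topological_space \<Rightarrow> 'a measure"
  assumes P: "transition_kernel P"
begin

lemma kernel_measurable: "P \<in> borel \<rightarrow>\<^sub>M subprob_algebra borel"
  using P by (simp add: transition_kernel_def measurable_prob_algebraD)

lemma prob_space_kernel: "prob_space (P x)"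
  using measurable_space[OF P[unfolded transition_kernel_def], of x] by (simp add: space_prob_algebra)

lemma sets_transition_kernel: "sets (P x) = sets borel"
  using measurable_space[OF P[unfolded transition_kernel_def], of x] by (simp add: space_prob_algebra)

lemma space_transition_kernel: "space (P x) = UNIV"
  using sets_eq_imp_space_eq[OF sets_transition_kernel[of x]] by simp

lemma emeasure_kernel_UNIV: "emeasure (P x) UNIV = 1"
  using prob_space.emeasure_space_1[OF prob_space_kernel[of x]] by (simp add: space_transition_kernel)

lemma path_weight_measurable:
  "\<forall>f\<in>set fs. f \<in> borel_measurable borel \<Longrightarrow> path_weight P fs \<in> borel_measurable borel"
proof (induction fs)
  case (Cons f fs)
  then have [measurable]: "f \<in> borel_measurable borel" "path_weight P fs \<in> borel_measurable borel"
    by auto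
  have "(\<lambda>x. \<integral>\<^sup>+z. path_weight P fs z \<partial>P x) \<in> borel_measurable borel"
    by (rule measurable_compose[OF kernel_measurable nn_integral_measurable_subprob_algebra]) simp
  then show ?case by (simp add: path_weight_def[symmetric])
qed (simp_all add: path_weight_Nil)

lemma path_weight_single: "path_weight P [f] = f"
  by (simp add: fun_eq_iff path_weight_Nil space_transition_kernel emeasure_kernel_UNIV)

text \<open>
  The last factor can be absorbed into the one before it. This matches the
  forward construction of the chain, where the newest coordinate is integrated first, and it is
  the induction step of \<open>nn_integral_chain_law\<close>.
\<close>

lemma path_weight_append2:
  "path_weight P (fs @ [f, h]) = path_weight P (fs @ [\<lambda>x. f x * (\<integral>\<^sup>+z. h z \<partial>P x)])"
  by (induction fs) (simp_all add: fun_eq_iff path_weight_single path_weight_Nil space_transition_kernel emeasure_kernel_UNIV)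

context
  fixes \<mu> :: "'a measure"
  assumes \<mu>: "prob_space \<mu>" "sets \<mu> = sets borel"
begin

interpretation IT: Ionescu_Tulcea "chain_step P \<mu>" "\<lambda>_. borel"
  by (rule Ionescu_Tulcea_chain_step[OF P \<mu>])

lemma nn_integral_chain_law_prefix:
  assumes F: "F \<in> borel_measurable (PiM {0..<n} (\<lambda>_. borel))"
  shows "(\<integral>\<^sup>+\<omega>. F (restrict \<omega> {0..<n}) \<partial>chain_law P \<mu>) = (\<integral>\<^sup>+\<omega>. F \<omega> \<partial>IT.C 0 n (\<lambda>_. undefined))"
proof -
  have "(\<lambda>\<omega>. restrict \<omega> {0..<n}) \<in> chain_law P \<mu> \<rightarrow>\<^sub>M PiM {0..<n} (\<lambda>_. borel)"
    unfolding measurable_cong_sets[OF sets_chain_law[OF P \<mu>] refl]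
    by (rule measurable_restrict_subset) simp
  then show ?thesis
    using F by (simp add: distr_chain_law_prefix[OF P \<mu>, symmetric] nn_integral_distr)
qed

lemma nn_integral_chain_law_0:
  assumes [measurable]: "f \<in> borel_measurable borel"
  shows "(\<integral>\<^sup>+\<omega>. f (\<omega> 0) \<partial>chain_law P \<mu>) = (\<integral>\<^sup>+x. f x \<partial>\<mu>)"
proof -
  let ?u = "\<lambda>_::nat. undefined :: 'a"
  have u: "?u \<in> space (PiM {0..<0} (\<lambda>_. borel))"
    by (simp add: space_PiM)
  have [measurable]: "(\<lambda>\<omega>. f (\<omega> 0)) \<in> borel_measurable (PiM {0..<Suc 0} (\<lambda>_. borel))"
    by measurable
  have C1: "IT.C 0 1 ?u = IT.eP 0 ?u"
    using bind_return[OF IT.measurable_eP u] by simp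
  have "(\<integral>\<^sup>+\<omega>. f (\<omega> 0) \<partial>chain_law P \<mu>) = (\<integral>\<^sup>+\<omega>. f (restrict \<omega> {0..<1} 0) \<partial>chain_law P \<mu>)"
    by simp
  also have "\<dots> = (\<integral>\<^sup>+\<omega>. f (\<omega> 0) \<partial>IT.C 0 1 ?u)"
    by (rule nn_integral_chain_law_prefix) simp
  also have "\<dots> = (\<integral>\<^sup>+x. f x \<partial>\<mu>)"
    unfolding C1 by (subst IT.nn_integral_eP[OF u]) (simp_all add: chain_step_def)
  finally show ?thesis .
qed

text \<open>
  The Markov property at time \<open>m\<close>, integrated against a function \<open>F\<close> of the past.
\<close>

lemma nn_integral_chain_law_step:
  assumes F [measurable]: "F \<in> borel_measurable (PiM {0..<Suc m} (\<lambda>_. borel))"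
    and f [measurable]: "f \<in> borel_measurable borel"
  shows "(\<integral>\<^sup>+\<omega>. F (restrict \<omega> {0..<Suc m}) * f (\<omega> (Suc m)) \<partial>chain_law P \<mu>) =
    (\<integral>\<^sup>+\<omega>. F (restrict \<omega> {0..<Suc m}) * (\<integral>\<^sup>+z. f z \<partial>P (\<omega> m)) \<partial>chain_law P \<mu>)"
proof -
  let ?u = "\<lambda>_::nat. undefined :: 'a"
  let ?M = "\<lambda>n. PiM {0..<n} (\<lambda>_. borel :: 'a measure)"
  have u: "?u \<in> space (?M 0)"
    by (simp add: space_PiM)
  have "(\<lambda>\<omega>. restrict \<omega> {0..<Suc m}) \<in> ?M (Suc (Suc m)) \<rightarrow>\<^sub>M ?M (Suc m)"
    by (rule measurable_restrict_subset) simp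
  from measurable_compose[OF this F]
  have G [measurable]: "(\<lambda>\<omega>. F (restrict \<omega> {0..<Suc m}) * f (\<omega> (Suc m))) \<in> borel_measurable (?M (Suc (Suc m)))"
    by (intro borel_measurable_times_ennreal measurable_compose[OF _ f] measurable_component_singleton) auto
  have "(\<lambda>\<omega>. \<integral>\<^sup>+z. f z \<partial>P (\<omega> m)) \<in> borel_measurable (?M (Suc m))"
    by (rule measurable_compose[OF _ nn_integral_measurable_subprob_algebra[OF f]],
        rule measurable_compose[OF _ kernel_measurable], rule measurable_component_singleton) simp
  then have G': "(\<lambda>\<omega>. F \<omega> * (\<integral>\<^sup>+z. f z \<partial>P (\<omega> m))) \<in> borel_measurable (?M (Suc m))"
    by (intro borel_measurable_times_ennreal F)
  have spaceC: "space (IT.C 0 (Suc m) ?u) = space (?M (Suc m))"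
    using IT.space_C[OF u, of "Suc m"] by simp
  have setsC: "sets (IT.C 0 (Suc m) ?u) = sets (?M (Suc m))"
    using IT.sets_C[OF u, of "Suc m"] by simp
  have "(\<integral>\<^sup>+\<omega>. F (restrict \<omega> {0..<Suc m}) * f (\<omega> (Suc m)) \<partial>chain_law P \<mu>) =
      (\<integral>\<^sup>+\<omega>. F (restrict (restrict \<omega> {0..<Suc (Suc m)}) {0..<Suc m}) *
        f (restrict \<omega> {0..<Suc (Suc m)} (Suc m)) \<partial>chain_law P \<mu>)"
    by (simp only: restrict_restrict Int_atLeastLessThan) simp
  also have "\<dots> = (\<integral>\<^sup>+\<omega>. F (restrict \<omega> {0..<Suc m}) * f (\<omega> (Suc m)) \<partial>IT.C 0 (Suc (Suc m)) ?u)"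
    by (rule nn_integral_chain_law_prefix[OF G])
  also have "\<dots> = (\<integral>\<^sup>+x. \<integral>\<^sup>+\<omega>. F (restrict \<omega> {0..<Suc m}) * f (\<omega> (Suc m)) \<partial>IT.eP (Suc m) x \<partial>IT.C 0 (Suc m) ?u)"
    unfolding IT.C.simps(2)[of 0 "Suc m"] add_0
    by (rule nn_integral_bind[OF G])
       (unfold measurable_cong_sets[OF setsC refl], rule IT.measurable_eP)
  also have "\<dots> = (\<integral>\<^sup>+x. F x * (\<integral>\<^sup>+z. f z \<partial>P (x m)) \<partial>IT.C 0 (Suc m) ?u)"
  proof (rule nn_integral_cong)
    fix x assume "x \<in> space (IT.C 0 (Suc m) ?u)"
    then have x: "x \<in> space (?M (Suc m))"
      by (simp only: spaceC)
    have r: "restrict (x(Suc m := z)) {0..<Suc m} = x" for z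
      using x by (auto simp: space_PiM PiE_def extensional_def fun_eq_iff)
    show "(\<integral>\<^sup>+\<omega>. F (restrict \<omega> {0..<Suc m}) * f (\<omega> (Suc m)) \<partial>IT.eP (Suc m) x) = F x * (\<integral>\<^sup>+z. f z \<partial>P (x m))"
      by (subst IT.nn_integral_eP[OF x G]) (simp add: r chain_step_def nn_integral_cmult measurable_cong_sets[OF sets_transition_kernel refl])
  qed
  also have "\<dots> = (\<integral>\<^sup>+\<omega>. F (restrict \<omega> {0..<Suc m}) * (\<integral>\<^sup>+z. f z \<partial>P (restrict \<omega> {0..<Suc m} m)) \<partial>chain_law P \<mu>)"
    by (rule nn_integral_chain_law_prefix[OF G', symmetric])
  finally show ?thesis by simp
qed

lemma nn_integral_chain_law:
  assumes "\<forall>f\<in>set fs. f \<in> borel_measurable borel"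
  shows "(\<integral>\<^sup>+\<omega>. (\<Prod>i<length fs. (fs ! i) (\<omega> i)) \<partial>chain_law P \<mu>) = (\<integral>\<^sup>+x. path_weight P fs x \<partial>\<mu>)"
  using assms
proof (induction "length fs" arbitrary: fs rule: less_induct)
  case less
  consider (0) "fs = []" | (1) f where "fs = [f]" | (2) hs f f' where "fs = hs @ [f, f']"
  proof (cases fs rule: rev_cases)
    case (snoc hs f')
    then show ?thesis
      using that by (cases hs rule: rev_cases) auto
  qed (use that in auto)
  then show ?case
  proof cases
    case 0
    then show ?thesis
      using prob_space.emeasure_space_1[OF \<mu>(1)]
        prob_space.emeasure_space_1[OF prob_space_chain_law[OF P \<mu>]] by (simp add: path_weight_Nil)
  next
    case (1 f)
    then show ?thesis
      using less.prems nn_integral_chain_law_0[of f]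
      by (simp add: path_weight_single)
  next
    case (2 hs f f')
    let ?m = "length hs"
    let ?k = "\<lambda>x. f x * (\<integral>\<^sup>+z. f' z \<partial>P x)"
    have [measurable]: "f \<in> borel_measurable borel" "f' \<in> borel_measurable borel"
      and hs: "\<And>i. i < ?m \<Longrightarrow> hs ! i \<in> borel_measurable borel"
      using less.prems 2 by auto
    have k: "?k \<in> borel_measurable borel"
      by (intro borel_measurable_times_ennreal
        measurable_compose[OF kernel_measurable nn_integral_measurable_subprob_algebra]) auto
    define F where "F = (\<lambda>\<omega>. (\<Prod>i<?m. (hs ! i) (\<omega> i)) * f (\<omega> ?m))"
    have F: "F \<in> borel_measurable (PiM {0..<Suc ?m} (\<lambda>_. borel))"
      unfolding F_def
      by (intro borel_measurable_times_ennreal borel_measurable_prod_ennreal measurable_compose[OF _ hs]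
            measurable_compose[OF _ \<open>f \<in> _\<close>] measurable_component_singleton) auto
    have Fr: "F (restrict \<omega> {0..<Suc ?m}) = F \<omega>" for \<omega>
      by (simp add: F_def)
    have "(\<integral>\<^sup>+\<omega>. (\<Prod>i<length fs. (fs ! i) (\<omega> i)) \<partial>chain_law P \<mu>) =
        (\<integral>\<^sup>+\<omega>. F \<omega> * f' (\<omega> (Suc ?m)) \<partial>chain_law P \<mu>)"
      by (simp add: 2 F_def nth_append)
    also have "\<dots> = (\<integral>\<^sup>+\<omega>. F \<omega> * (\<integral>\<^sup>+z. f' z \<partial>P (\<omega> ?m)) \<partial>chain_law P \<mu>)"
      using nn_integral_chain_law_step[OF F, of f'] by (simp add: Fr)
    also have "\<dots> = (\<integral>\<^sup>+\<omega>. (\<Prod>i<length (hs @ [?k]). ((hs @ [?k]) ! i) (\<omega> i)) \<partial>chain_law P \<mu>)"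
      by (simp add: F_def nth_append mult.assoc)
    also have "\<dots> = (\<integral>\<^sup>+x. path_weight P (hs @ [?k]) x \<partial>\<mu>)"
      using less.prems k by (intro less.hyps) (auto simp: 2)
    finally show ?thesis
      unfolding 2 path_weight_append2 .
  qed
qed

text \<open>
  A cylinder set over finitely many coordinates has an indicator of product form, with
  the constant 1 at the unconstrained coordinates. So a law on path space is that of the
  chain as soon as it has the right expectations of products. The first factor is kept apart
  because it is the one that the shift and the change of initial law treat separately.
\<close>

lemma chain_law_eqI:
  assumes N: "sets N = sets paths"
    and eq: "\<And>f fs. f \<in> borel_measurable borel \<Longrightarrow> \<forall>f\<in>set fs. f \<in> borel_measurable borel \<Longrightarrow>
      (\<integral>\<^sup>+\<omega>. f (\<omega> 0) * (\<Prod>i<length fs. (fs ! i) (\<omega> (Suc i))) \<partial>N) = (\<integral>\<^sup>+x. path_weight P (f # fs) x \<partial>\<mu>)"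
  shows "N = chain_law P \<mu>"
proof (rule measure_eqI_PiM_infinite[symmetric, OF sets_chain_law[OF P \<mu>] N])
  show "finite_measure (chain_law P \<mu>)"
    using prob_space_chain_law[OF P \<mu>] by (rule prob_space.finite_measure)
  fix A and J :: "nat set"
  assume J: "finite J" and A: "\<And>i. i \<in> J \<Longrightarrow> A i \<in> sets (borel :: 'a measure)"
  define h :: "nat \<Rightarrow> 'a \<Rightarrow> ennreal" where "h = (\<lambda>i. if i \<in> J then indicator (A i) else (\<lambda>_. 1))"
  have h [measurable]: "h i \<in> borel_measurable borel" for i
    using A by (auto simp: h_def)
  define n where "n = Max (insert 0 J)"
  have n: "i < Suc n" if "i \<in> J" for i
    using J that by (auto simp: n_def less_Suc_eq_le)
  let ?fs = "map (\<lambda>i. h (Suc i)) [0..<n]"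
  let ?X = "prod_emb UNIV (\<lambda>_. borel) J (Pi\<^sub>E J A)"
  have X: "?X \<in> sets paths"
    using J A by (intro sets_PiM_I) auto
  have ind: "indicator ?X \<omega> = h 0 (\<omega> 0) * (\<Prod>i<length ?fs. (?fs ! i) (\<omega> (Suc i)))" for \<omega>
  proof -
    have "indicator ?X \<omega> = (indicator {\<omega>. \<forall>i\<in>J. \<omega> i \<in> A i} \<omega> :: ennreal)"
      by (auto simp: prod_emb_def space_PiM indicator_def PiE_def Pi_def)
    also have "\<dots> = (\<Prod>i<Suc n. h i (\<omega> i))"
    proof (cases "\<forall>i\<in>J. \<omega> i \<in> A i")
      case False
      then obtain i where "i \<in> J" "\<omega> i \<notin> A i" by auto
      then have "(\<Prod>i<Suc n. h i (\<omega> i)) = 0"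
        using n[of i] by (intro prod_zero) (auto simp: h_def intro!: bexI[of _ i])
      then show ?thesis using False by auto
    next
      case True
      then have "(\<Prod>i<Suc n. h i (\<omega> i)) = 1"
        by (intro prod.neutral) (auto simp: h_def)
      then show ?thesis using True by simp
    qed
    also have "\<dots> = h 0 (\<omega> 0) * (\<Prod>i<n. h (Suc i) (\<omega> (Suc i)))"
      by (rule prod.lessThan_Suc_shift)
    finally show ?thesis by simp
  qed
  have em: "emeasure N' ?X = (\<integral>\<^sup>+\<omega>. h 0 (\<omega> 0) * (\<Prod>i<length ?fs. (?fs ! i) (\<omega> (Suc i))) \<partial>N')"
    if "sets N' = sets paths" for N'
    using X that nn_integral_indicator[of ?X N'] by (simp only: ind)
  have "(\<integral>\<^sup>+\<omega>. h 0 (\<omega> 0) * (\<Prod>i<length ?fs. (?fs ! i) (\<omega> (Suc i))) \<partial>chain_law P \<mu>) =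
      (\<integral>\<^sup>+x. path_weight P (h 0 # ?fs) x \<partial>\<mu>)"
    using nn_integral_chain_law[of "h 0 # ?fs"] by (simp add: prod.lessThan_Suc_shift del: prod.lessThan_Suc)
  also have "\<dots> = (\<integral>\<^sup>+\<omega>. h 0 (\<omega> 0) * (\<Prod>i<length ?fs. (?fs ! i) (\<omega> (Suc i))) \<partial>N)"
    by (rule eq[symmetric]) auto
  finally show "emeasure (chain_law P \<mu>) ?X = emeasure N ?X"
    by (simp only: em[OF N] em[OF sets_chain_law[OF P \<mu>]])
qed

end

end

section \<open>Shift and change of initial law\<close>

lemma measurable_shift:
  "(\<lambda>\<omega> n. \<omega> (Suc n)) \<in> paths \<rightarrow>\<^sub>M (paths :: (nat \<Rightarrow> 'a::topological_space) measure)"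
  by (intro measurable_PiM_single') (auto simp: space_PiM)

lemma ergodic_chainD:
  assumes "ergodic_chain P \<nu>" and "f \<in> borel_measurable borel" and "\<And>x. \<bar>f x\<bar> \<le> (B :: real)"
  shows "AE \<omega> in chain_law P \<nu>. (\<lambda>n. (\<Sum>k<n. f (\<omega> k)) / real n) \<longlonglongrightarrow> (\<integral>x. f x \<partial>\<nu>)"
proof -
  have "bounded (range f)"
    using assms(3) by (auto simp: bounded_iff)
  with assms(1,2) show ?thesis
    unfolding ergodic_chain_def by blast
qed

context
  fixes P :: "'a::topological_space \<Rightarrow> 'a measure"
  assumes P: "transition_kernel P"
begin

lemma step_distribution:
  assumes \<mu>: "prob_space \<mu>" "sets \<mu> = sets borel"
  shows "prob_space (\<mu> \<bind> P)" and "sets (\<mu> \<bind> P) = sets borel"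
proof -
  have PP: "P \<in> \<mu> \<rightarrow>\<^sub>M subprob_algebra borel"
    using kernel_measurable[OF P] by (simp add: measurable_cong_sets[OF \<mu>(2) refl])
  show "prob_space (\<mu> \<bind> P)"
    by (rule prob_space.prob_space_bind[OF \<mu>(1) _ PP]) (simp add: prob_space_kernel[OF P])
  show "sets (\<mu> \<bind> P) = sets borel"
    by (rule sets_bind_measurable[OF PP prob_space.not_empty[OF \<mu>(1)]])
qed

lemma nn_integral_step_distribution:
  assumes "sets \<mu> = sets borel" and f: "f \<in> borel_measurable borel"
  shows "(\<integral>\<^sup>+x. f x \<partial>(\<mu> \<bind> P)) = (\<integral>\<^sup>+x. \<integral>\<^sup>+z. f z \<partial>P x \<partial>\<mu>)"
  using kernel_measurable[OF P]
  by (intro nn_integral_bind[OF f]) (simp add: measurable_cong_sets[OF assms(1) refl])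

lemma distr_chain_law_0:
  assumes \<mu>: "prob_space \<mu>" "sets \<mu> = sets borel"
  shows "distr (chain_law P \<mu>) borel (\<lambda>\<omega>. \<omega> 0) = \<mu>"
proof (rule measure_eqI)
  fix A :: "'a set" assume "A \<in> sets (distr (chain_law P \<mu>) borel (\<lambda>\<omega>. \<omega> 0))"
  then have A: "A \<in> sets borel" by simp
  have m: "(\<lambda>\<omega>. \<omega> 0) \<in> chain_law P \<mu> \<rightarrow>\<^sub>M borel"
    by (simp add: measurable_cong_sets[OF sets_chain_law[OF P \<mu>] refl])
  have "emeasure (distr (chain_law P \<mu>) borel (\<lambda>\<omega>. \<omega> 0)) A =
      (\<integral>\<^sup>+\<omega>. indicator A (\<omega> 0) \<partial>chain_law P \<mu>)"
    using A m by (subst nn_integral_indicator[symmetric]) (simp_all add: nn_integral_distr del: nn_integral_indicator)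
  then show "emeasure (distr (chain_law P \<mu>) borel (\<lambda>\<omega>. \<omega> 0)) A = emeasure \<mu> A"
    using A by (simp add: nn_integral_chain_law_0[OF P \<mu>] \<mu>(2))
qed (simp add: \<mu>(2))

text \<open>
  The Markov property at time 1. For \<open>\<mu>\<close> the point mass at \<open>y\<close> the shifted path is a chain
  with initial law \<open>P(y)\<close>; for \<open>\<mu>\<close> invariant this is stationarity.
\<close>

lemma distr_chain_law_shift:
  assumes \<mu>: "prob_space \<mu>" "sets \<mu> = sets borel"
  shows "distr (chain_law P \<mu>) paths (\<lambda>\<omega> n. \<omega> (Suc n)) = chain_law P (\<mu> \<bind> P)"
proof (rule chain_law_eqI[OF P step_distribution[OF \<mu>]])
  fix f :: "'a \<Rightarrow> ennreal" and fs :: "('a \<Rightarrow> ennreal) list"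
  assume f [measurable]: "f \<in> borel_measurable borel" and fs: "\<forall>f\<in>set fs. f \<in> borel_measurable borel"
  have [measurable]: "fs ! i \<in> borel_measurable borel" if "i < length fs" for i
    using fs that by auto
  have m: "(\<lambda>\<omega>. f (\<omega> 0) * (\<Prod>i<length fs. (fs ! i) (\<omega> (Suc i)))) \<in> borel_measurable paths"
    by measurable
  have sh: "(\<lambda>\<omega> n. \<omega> (Suc n)) \<in> chain_law P \<mu> \<rightarrow>\<^sub>M paths"
    by (simp add: measurable_shift measurable_cong_sets[OF sets_chain_law[OF P \<mu>] refl])
  have "(\<integral>\<^sup>+\<omega>. f (\<omega> 0) * (\<Prod>i<length fs. (fs ! i) (\<omega> (Suc i)))
        \<partial>distr (chain_law P \<mu>) paths (\<lambda>\<omega> n. \<omega> (Suc n))) =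
      (\<integral>\<^sup>+\<omega>. f (\<omega> (Suc 0)) * (\<Prod>i<length fs. (fs ! i) (\<omega> (Suc (Suc i)))) \<partial>chain_law P \<mu>)"
    using m by (subst nn_integral_distr[OF sh]) simp_all
  also have "\<dots> = (\<integral>\<^sup>+x. path_weight P ((\<lambda>_. 1) # f # fs) x \<partial>\<mu>)"
    using nn_integral_chain_law[OF P \<mu>, of "(\<lambda>_. 1) # f # fs"] f fs
    by (simp add: prod.lessThan_Suc_shift del: prod.lessThan_Suc path_weight.simps(2))
  also have "\<dots> = (\<integral>\<^sup>+x. path_weight P (f # fs) x \<partial>(\<mu> \<bind> P))"
    using f fs path_weight_measurable[OF P, of "f # fs"]
    by (subst nn_integral_step_distribution[OF \<mu>(2)]) (simp_all add: path_weight_Cons)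
  finally show "(\<integral>\<^sup>+\<omega>. f (\<omega> 0) * (\<Prod>i<length fs. (fs ! i) (\<omega> (Suc i)))
        \<partial>distr (chain_law P \<mu>) paths (\<lambda>\<omega> n. \<omega> (Suc n))) =
      (\<integral>\<^sup>+x. path_weight P (f # fs) x \<partial>(\<mu> \<bind> P))" .
qed simp

text \<open>
  The transition mechanism does not see the initial law, so a change of the initial law by
  a density \<open>h\<close> changes the law of the chain by the density \<open>h(Y\<^sub>0)\<close>.
\<close>

lemma chain_law_density:
  assumes \<mu>: "prob_space \<mu>" "sets \<mu> = sets borel"
    and h [measurable]: "h \<in> borel_measurable borel" and h1: "prob_space (density \<mu> h)"
  shows "density (chain_law P \<mu>) (\<lambda>\<omega>. h (\<omega> 0)) = chain_law P (density \<mu> h)"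
proof (rule chain_law_eqI[OF P h1])
  fix f :: "'a \<Rightarrow> ennreal" and fs :: "('a \<Rightarrow> ennreal) list"
  assume f [measurable]: "f \<in> borel_measurable borel" and fs: "\<forall>f\<in>set fs. f \<in> borel_measurable borel"
  have [measurable]: "fs ! i \<in> borel_measurable borel" if "i < length fs" for i
    using fs that by auto
  note cong = measurable_cong_sets[OF sets_chain_law[OF P \<mu>] refl]
  have m: "(\<lambda>\<omega>. f (\<omega> 0) * (\<Prod>i<length fs. (fs ! i) (\<omega> (Suc i)))) \<in> borel_measurable paths"
    "(\<lambda>\<omega>. h (\<omega> 0)) \<in> borel_measurable paths"
    by measurable
  have "(\<integral>\<^sup>+\<omega>. f (\<omega> 0) * (\<Prod>i<length fs. (fs ! i) (\<omega> (Suc i)))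
        \<partial>density (chain_law P \<mu>) (\<lambda>\<omega>. h (\<omega> 0))) =
      (\<integral>\<^sup>+\<omega>. (h (\<omega> 0) * f (\<omega> 0)) * (\<Prod>i<length fs. (fs ! i) (\<omega> (Suc i))) \<partial>chain_law P \<mu>)"
    using m by (subst nn_integral_density) (simp_all add: cong mult.assoc)
  also have "\<dots> = (\<integral>\<^sup>+x. path_weight P ((\<lambda>x. h x * f x) # fs) x \<partial>\<mu>)"
    using nn_integral_chain_law[OF P \<mu>, of "(\<lambda>x. h x * f x) # fs"] f fs
    by (simp add: prod.lessThan_Suc_shift del: prod.lessThan_Suc path_weight.simps(2))
  also have "\<dots> = (\<integral>\<^sup>+x. path_weight P (f # fs) x \<partial>density \<mu> h)"
    using f fs h path_weight_measurable[OF P, of "f # fs"]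
    by (subst nn_integral_density) (simp_all add: path_weight_Cons measurable_cong_sets[OF \<mu>(2) refl] mult.assoc)
  finally show "(\<integral>\<^sup>+\<omega>. f (\<omega> 0) * (\<Prod>i<length fs. (fs ! i) (\<omega> (Suc i)))
        \<partial>density (chain_law P \<mu>) (\<lambda>\<omega>. h (\<omega> 0))) =
      (\<integral>\<^sup>+x. path_weight P (f # fs) x \<partial>density \<mu> h)" .
qed (simp_all add: \<mu>(2) sets_chain_law[OF P \<mu>])

text \<open>
  With the Radon-Nikodym density \<open>h\<close> of \<open>\<mu>\<close> with respect to \<open>\<nu>\<close>, the two laws on path space
  are related by the density \<open>h(Y\<^sub>0)\<close>.
\<close>

lemma AE_chain_law_absolutely_continuous:
  assumes \<nu>: "prob_space \<nu>" "sets \<nu> = sets borel" and \<mu>: "prob_space \<mu>" "sets \<mu> = sets borel"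
    and ac: "absolutely_continuous \<nu> \<mu>" and AE: "AE \<omega> in chain_law P \<nu>. Q \<omega>"
  shows "AE \<omega> in chain_law P \<mu>. Q \<omega>"
proof -
  interpret \<nu>: prob_space \<nu> by fact
  obtain h where h: "h \<in> borel_measurable \<nu>" and \<mu>h: "density \<nu> h = \<mu>"
    using \<nu>.Radon_Nikodym[OF ac] \<mu>(2) \<nu>(2) by auto
  have h' [measurable]: "h \<in> borel_measurable borel"
    using h by (simp add: measurable_cong_sets[OF \<nu>(2) refl])
  have m: "(\<lambda>\<omega>. h (\<omega> 0)) \<in> borel_measurable (chain_law P \<nu>)"
    by (simp add: measurable_cong_sets[OF sets_chain_law[OF P \<nu>] refl])
  have eq: "chain_law P \<mu> = density (chain_law P \<nu>) (\<lambda>\<omega>. h (\<omega> 0))"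
    using chain_law_density[OF \<nu> h'] \<mu>(1) by (simp add: \<mu>h)
  show ?thesis
    unfolding eq AE_density[OF m] using AE by (rule eventually_mono) simp
qed

lemma distr_chain_law_stationary:
  assumes inv: "invariant_distribution P \<mu>"
  shows "distr (chain_law P \<mu>) borel (\<lambda>\<omega>. \<omega> k) = \<mu>"
proof (induction k)
  case 0
  then show ?case
    using inv by (intro distr_chain_law_0) (auto simp: invariant_distribution_def)
next
  case (Suc k)
  have \<mu>: "prob_space \<mu>" "sets \<mu> = sets borel" "\<mu> \<bind> P = \<mu>"
    using inv by (auto simp: invariant_distribution_def)
  have "distr (distr (chain_law P \<mu>) paths (\<lambda>\<omega> n. \<omega> (Suc n))) borel (\<lambda>\<omega>. \<omega> k) = 
     distr (chain_law P \<mu>) borel (\<lambda>\<omega>. \<omega> (Suc k))"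
    by (subst distr_distr) (simp_all add: comp_def measurable_shift measurable_cong_sets[OF sets_chain_law[OF P \<mu>(1,2)] refl])
  then show ?case
    using Suc by (simp add: distr_chain_law_shift[OF \<mu>(1,2)] \<mu>(3))
qed

section \<open>The invariant distribution\<close>

lemma Cesaro_expectation:
  fixes f :: "'a \<Rightarrow> real"
  assumes \<mu>: "prob_space \<mu>" "sets \<mu> = sets borel"
    and f [measurable]: "f \<in> borel_measurable borel" and B: "\<And>x. \<bar>f x\<bar> \<le> B"
    and lim: "AE \<omega> in chain_law P \<mu>. (\<lambda>n. (\<Sum>k<n. f (\<omega> k)) / real n) \<longlonglongrightarrow> c"
  shows "(\<lambda>n. (\<Sum>k<n. \<integral>\<omega>. f (\<omega> k) \<partial>chain_law P \<mu>) / real n) \<longlonglongrightarrow> c"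
proof -
  interpret Q: prob_space "chain_law P \<mu>"
    by (rule prob_space_chain_law[OF P \<mu>])
  note cong = measurable_cong_sets[OF sets_chain_law[OF P \<mu>] refl]
  have m: "(\<lambda>\<omega>. f (\<omega> k)) \<in> borel_measurable (chain_law P \<mu>)" for k
    by (simp add: cong)
  have int: "integrable (chain_law P \<mu>) (\<lambda>\<omega>. f (\<omega> k))" for k
    using B m by (intro Q.integrable_const_bound[where B=B]) auto
  have "(\<lambda>n. \<integral>\<omega>. (\<Sum>k<n. f (\<omega> k)) / real n \<partial>chain_law P \<mu>) \<longlonglongrightarrow> (\<integral>\<omega>. c \<partial>chain_law P \<mu>)"
  proof (rule integral_dominated_convergence[where w="\<lambda>_. \<bar>B\<bar>"])
    show "AE \<omega> in chain_law P \<mu>. norm ((\<Sum>k<n. f (\<omega> k)) / real n) \<le> \<bar>B\<bar>" for n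
    proof (rule AE_I2)
      fix \<omega>
      have "\<bar>\<Sum>k<n. f (\<omega> k)\<bar> \<le> (\<Sum>k<n. \<bar>B\<bar>)"
        by (rule sum_abs[THEN order_trans], rule sum_mono) (rule order_trans[OF B abs_ge_self])
      then show "norm ((\<Sum>k<n. f (\<omega> k)) / real n) \<le> \<bar>B\<bar>"
        by (cases "n = 0") (auto simp: field_simps)
    qed
  qed (use lim m in \<open>auto intro!: borel_measurable_divide borel_measurable_sum\<close>)
  then show ?thesis
    using int by (simp add: Q.prob_space)
qed

text \<open>
  Both \<open>f\<close> and \<open>P f\<close> have time averages, and in expectation these are the Cesaro means of
  \<open>a\<^sub>k = E f(Y\<^sub>k)\<close> and of \<open>a\<^sub>k\<^sub>+\<^sub>1 = E (P f)(Y\<^sub>k)\<close>. The two means differ by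
  \<open>(a\<^sub>n - a\<^sub>0) / n\<close>, which tends to 0, so the limits \<open>\<integral> f d\<nu>\<close> and \<open>\<integral> P f d\<nu>\<close> agree.
\<close>

lemma invariant_distribution_ergodic:
  assumes \<nu>: "prob_space \<nu>" "sets \<nu> = sets borel" and erg: "ergodic_chain P \<nu>"
  shows "invariant_distribution P \<nu>"
proof -
  interpret \<nu>: prob_space \<nu> by fact
  interpret Q: prob_space "chain_law P \<nu>"
    by (rule prob_space_chain_law[OF P \<nu>])
  interpret S: prob_space "\<nu> \<bind> P"
    by (rule step_distribution(1)[OF \<nu>])
  note cong = measurable_cong_sets[OF sets_chain_law[OF P \<nu>] refl]
  have "measure (\<nu> \<bind> P) A = measure \<nu> A" if A [measurable]: "A \<in> sets borel" for A
  proof -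
    define f where "f = (indicator A :: 'a \<Rightarrow> real)"
    define h where "h x = measure (P x) A" for x
    have f [measurable]: "f \<in> borel_measurable borel" by (simp add: f_def)
    have h [measurable]: "h \<in> borel_measurable borel"
      unfolding h_def by (rule measurable_compose[OF kernel_measurable[OF P] measurable_measure_subprob_algebra[OF A]])
    have h1: "\<bar>h x\<bar> \<le> 1" for x
      using prob_space.prob_le_1[OF prob_space_kernel[OF P]] by (simp add: h_def)
    have h0: "0 \<le> h x" for x
      by (simp add: h_def)
    have f1: "\<bar>f x\<bar> \<le> 1" for x
      by (simp add: f_def)
    define a where "a k = (\<integral>\<omega>. f (\<omega> k) \<partial>chain_law P \<nu>)" for k
    have mf: "(\<lambda>\<omega>. f (\<omega> k)) \<in> borel_measurable (chain_law P \<nu>)"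
      and mh: "(\<lambda>\<omega>. h (\<omega> k)) \<in> borel_measurable (chain_law P \<nu>)" for k
      by (simp_all add: cong)
    have a1: "\<bar>a k\<bar> \<le> 1" for k
    proof -
      have "\<bar>a k\<bar> \<le> (\<integral>\<omega>. 1 \<partial>chain_law P \<nu>)"
        unfolding a_def by (rule integral_abs_bound[THEN order_trans], rule integral_mono')
          (simp_all add: f1)
      then show ?thesis by (simp add: Q.prob_space)
    qed
    have "(\<lambda>n. (\<Sum>k<n. a k) / real n) \<longlonglongrightarrow> (\<integral>x. f x \<partial>\<nu>)"
      unfolding a_def by (intro Cesaro_expectation[OF \<nu> f f1] ergodic_chainD[OF erg f f1])
    moreover have ah: "(\<integral>\<omega>. h (\<omega> k) \<partial>chain_law P \<nu>) = a (Suc k)" for k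
    proof -
      have "ennreal (a (Suc k)) = (\<integral>\<^sup>+\<omega>. ennreal (f (\<omega> (Suc k))) \<partial>chain_law P \<nu>)"
        unfolding a_def using mf f1
        by (intro nn_integral_eq_integral[symmetric] Q.integrable_const_bound[where B=1]) (auto simp: f_def)
      also have "\<dots> = (\<integral>\<^sup>+\<omega>. \<integral>\<^sup>+z. ennreal (f z) \<partial>P (\<omega> k) \<partial>chain_law P \<nu>)"
        using nn_integral_chain_law_step[OF P \<nu>, of "\<lambda>_. 1" k "\<lambda>z. ennreal (f z)"] by simp
      also have "\<dots> = (\<integral>\<^sup>+\<omega>. ennreal (h (\<omega> k)) \<partial>chain_law P \<nu>)"
        by (simp add: f_def h_def ennreal_indicator sets_transition_kernel[OF P]
            finite_measure.emeasure_eq_measure[OF prob_space.finite_measure[OF prob_space_kernel[OF P]]])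
      also have "\<dots> = ennreal (\<integral>\<omega>. h (\<omega> k) \<partial>chain_law P \<nu>)"
        using mh h1
        by (intro nn_integral_eq_integral Q.integrable_const_bound[where B=1]) (auto simp: h_def)
      finally show ?thesis
        by (subst (asm) ennreal_inj) (auto simp: a_def f_def h_def)
    qed
    moreover have "(\<lambda>n. (\<Sum>k<n. a (Suc k)) / real n) \<longlonglongrightarrow> (\<integral>x. h x \<partial>\<nu>)"
      unfolding ah[symmetric] by (intro Cesaro_expectation[OF \<nu> h h1] ergodic_chainD[OF erg h h1])
    ultimately have "(\<lambda>n. (\<Sum>k<n. a (Suc k)) / real n - (\<Sum>k<n. a k) / real n) \<longlonglongrightarrow> (\<integral>x. h x \<partial>\<nu>) - (\<integral>x. f x \<partial>\<nu>)"
      by (intro tendsto_diff)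
    moreover have "(\<Sum>k<n. a (Suc k)) / real n - (\<Sum>k<n. a k) / real n = (a n - a 0) / real n" for n
      using sum_lessThan_telescope[of a n] by (simp add: diff_divide_distrib[symmetric] sum_subtractf)
    moreover have "(\<lambda>n. (a n - a 0) / real n) \<longlonglongrightarrow> 0"
    proof (rule Lim_null_comparison)
      show "\<forall>\<^sub>F n in sequentially. norm ((a n - a 0) / real n) \<le> 2 / real n"
      proof (rule always_eventually, rule allI)
        fix n
        have "\<bar>a n - a 0\<bar> \<le> 2" using a1[of n] a1[of 0] by linarith
        then show "norm ((a n - a 0) / real n) \<le> 2 / real n"
          by (simp add: divide_right_mono)
      qed
    qed (rule lim_const_over_n)
    ultimately have "(\<integral>x. h x \<partial>\<nu>) = (\<integral>x. f x \<partial>\<nu>)"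
      using LIMSEQ_unique by fastforce
    moreover have "ennreal (\<integral>x. h x \<partial>\<nu>) = emeasure (\<nu> \<bind> P) A"
    proof -
      have "emeasure (\<nu> \<bind> P) A = (\<integral>\<^sup>+x. emeasure (P x) A \<partial>\<nu>)"
        using nn_integral_step_distribution[OF \<nu>(2), of "indicator A"]
        by (simp add: step_distribution(2)[OF \<nu>] sets_transition_kernel[OF P])
      also have "\<dots> = (\<integral>\<^sup>+x. ennreal (h x) \<partial>\<nu>)"
        by (simp add: h_def
            finite_measure.emeasure_eq_measure[OF prob_space.finite_measure[OF prob_space_kernel[OF P]]])
      also have "\<dots> = ennreal (\<integral>x. h x \<partial>\<nu>)"
        using h h1 by (intro nn_integral_eq_integral \<nu>.integrable_const_bound[where B=1])
          (auto simp: measurable_cong_sets[OF \<nu>(2) refl] h0)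
      finally show ?thesis by simp
    qed
    moreover have "(\<integral>x. f x \<partial>\<nu>) = measure \<nu> A"
      using A \<nu>(2) by (simp add: f_def sets_eq_imp_space_eq[OF \<nu>(2)])
    ultimately show ?thesis
      by (simp add: S.emeasure_eq_measure)
  qed
  then have "\<nu> \<bind> P = \<nu>"
    by (intro measure_eqI) (simp_all add: step_distribution(2)[OF \<nu>] \<nu>(2) S.emeasure_eq_measure \<nu>.emeasure_eq_measure)
  then show ?thesis
    using \<nu> by (simp add: invariant_distribution_def)
qed

lemma absolutely_continuous_step_distribution:
  assumes \<nu>: "sets \<nu> = sets borel" and ac: "\<And>x. absolutely_continuous \<nu> (P x)"
    and \<mu>: "prob_space \<mu>" "sets \<mu> = sets borel"
  shows "absolutely_continuous \<nu> (\<mu> \<bind> P)"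
  unfolding absolutely_continuous_def
proof (rule subsetI, rule null_setsI)
  fix N assume N: "N \<in> null_sets \<nu>"
  then have Nb: "N \<in> sets borel"
    using \<nu> by auto
  then show "N \<in> sets (\<mu> \<bind> P)"
    by (simp add: step_distribution(2)[OF \<mu>])
  have "emeasure (P x) N = 0" for x
    using ac[of x] N by (auto simp: absolutely_continuous_def null_sets_def)
  then show "emeasure (\<mu> \<bind> P) N = 0"
    using nn_integral_step_distribution[OF \<mu>(2), of "indicator N"] Nb
    by (simp add: step_distribution(2)[OF \<mu>] sets_transition_kernel[OF P])
qed

text \<open>
  An invariant \<open>\<mu> = \<mu>P\<close> inherits absolute continuity with respect to \<open>\<nu>\<close> from the kernel. The
  ergodic averages therefore converge to \<open>\<integral> f d\<nu>\<close> also for the chain started from \<open>\<mu>\<close>, where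
  their expectation is constantly \<open>\<integral> f d\<mu>\<close>.
\<close>

lemma invariant_distribution_unique:
  assumes \<nu>: "prob_space \<nu>" "sets \<nu> = sets borel" and erg: "ergodic_chain P \<nu>"
    and ac: "\<And>x. absolutely_continuous \<nu> (P x)"
    and inv: "invariant_distribution P \<mu>"
  shows "\<mu> = \<nu>"
proof -
  have \<mu>: "prob_space \<mu>" "sets \<mu> = sets borel" "\<mu> \<bind> P = \<mu>"
    using inv by (auto simp: invariant_distribution_def)
  interpret \<mu>: prob_space \<mu> by fact
  interpret \<nu>: prob_space \<nu> by fact
  have ac\<mu>: "absolutely_continuous \<nu> \<mu>"
    using absolutely_continuous_step_distribution[OF \<nu>(2) ac \<mu>(1,2)] by (simp add: \<mu>(3))
  have "measure \<mu> A = measure \<nu> A" if A [measurable]: "A \<in> sets borel" for A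
  proof -
    define f where "f = (indicator A :: 'a \<Rightarrow> real)"
    have f [measurable]: "f \<in> borel_measurable borel" by (simp add: f_def)
    have f1: "\<bar>f x\<bar> \<le> 1" for x
      by (simp add: f_def)
    have "AE \<omega> in chain_law P \<nu>. (\<lambda>n. (\<Sum>k<n. f (\<omega> k)) / real n) \<longlonglongrightarrow> (\<integral>x. f x \<partial>\<nu>)"
      by (rule ergodic_chainD[OF erg f f1])
    from AE_chain_law_absolutely_continuous[OF \<nu> \<mu>(1,2) ac\<mu> this]
    have "(\<lambda>n. (\<Sum>k<n. \<integral>\<omega>. f (\<omega> k) \<partial>chain_law P \<mu>) / real n) \<longlonglongrightarrow> (\<integral>x. f x \<partial>\<nu>)"
      by (intro Cesaro_expectation[OF \<mu>(1,2) f f1])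
    moreover have "(\<integral>\<omega>. f (\<omega> k) \<partial>chain_law P \<mu>) = (\<integral>x. f x \<partial>\<mu>)" for k
      by (subst (2) distr_chain_law_stationary[OF inv, of k, symmetric], subst integral_distr)
        (simp_all add: measurable_cong_sets[OF sets_chain_law[OF P \<mu>(1,2)] refl])
    ultimately have "(\<lambda>n. (\<Sum>k<n. \<integral>x. f x \<partial>\<mu>) / real n) \<longlonglongrightarrow> (\<integral>x. f x \<partial>\<nu>)"
      by simp
    moreover have "(\<lambda>n. (\<Sum>k<n. \<integral>x. f x \<partial>\<mu>) / real n) \<longlonglongrightarrow> (\<integral>x. f x \<partial>\<mu>)"
      by (rule tendsto_eventually, rule eventually_mono[OF eventually_gt_at_top[of 0]]) simp
    ultimately have "(\<integral>x. f x \<partial>\<mu>) = (\<integral>x. f x \<partial>\<nu>)"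
      using LIMSEQ_unique by blast
    then show ?thesis
      by (simp add: f_def sets_eq_imp_space_eq[OF \<nu>(2)] sets_eq_imp_space_eq[OF \<mu>(2)])
  qed
  then show ?thesis
    by (intro measure_eqI) (simp_all add: \<mu>(2) \<nu>(2) \<mu>.emeasure_eq_measure \<nu>.emeasure_eq_measure)
qed

end

section \<open>Rates of moments\<close>

lemma Lr_space_real:
  "f \<in> Lr_space (ereal r) M \<longleftrightarrow> f \<in> borel_measurable M \<and> integrable M (\<lambda>x. \<bar>f x\<bar> powr r)"
  by (simp add: Lr_space_def)

lemma powr_abs_add_le:
  fixes a b r :: real
  assumes "0 < r"
  shows "\<bar>a + b\<bar> powr r \<le> 2 powr r * (\<bar>a\<bar> powr r + \<bar>b\<bar> powr r)"
proof -
  have "\<bar>a + b\<bar> powr r \<le> (2 * max \<bar>a\<bar> \<bar>b\<bar>) powr r"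
    using assms by (intro powr_mono2) auto
  also have "\<dots> = 2 powr r * max \<bar>a\<bar> \<bar>b\<bar> powr r"
    by (simp add: powr_mult)
  also have "max \<bar>a\<bar> \<bar>b\<bar> powr r \<le> \<bar>a\<bar> powr r + \<bar>b\<bar> powr r"
    by (cases "\<bar>a\<bar> \<le> \<bar>b\<bar>") (auto simp: max_def)
  finally show ?thesis by simp
qed

lemma Lr_space_add:
  assumes "0 < r" and X: "X \<in> Lr_space (ereal r) M" and Y: "Y \<in> Lr_space (ereal r) M"
  shows "(\<lambda>x. X x + Y x) \<in> Lr_space (ereal r) M"
    and "(\<integral>x. \<bar>X x + Y x\<bar> powr r \<partial>M) \<le>
      2 powr r * ((\<integral>x. \<bar>X x\<bar> powr r \<partial>M) + (\<integral>x. \<bar>Y x\<bar> powr r \<partial>M))"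
proof -
  have [measurable]: "X \<in> borel_measurable M" "Y \<in> borel_measurable M"
    and int: "integrable M (\<lambda>x. \<bar>X x\<bar> powr r)" "integrable M (\<lambda>x. \<bar>Y x\<bar> powr r)"
    using X Y by (auto simp: Lr_space_real)
  have i: "integrable M (\<lambda>x. 2 powr r * (\<bar>X x\<bar> powr r + \<bar>Y x\<bar> powr r))"
    using int by (intro integrable_mult_right Bochner_Integration.integrable_add)
  have j: "integrable M (\<lambda>x. \<bar>X x + Y x\<bar> powr r)"
    by (rule Bochner_Integration.integrable_bound[OF i]) (use assms in \<open>auto intro!: powr_abs_add_le\<close>)
  then show "(\<lambda>x. X x + Y x) \<in> Lr_space (ereal r) M"
    by (simp add: Lr_space_real)
  have "(\<integral>x. \<bar>X x + Y x\<bar> powr r \<partial>M) \<le> (\<integral>x. 2 powr r * (\<bar>X x\<bar> powr r + \<bar>Y x\<bar> powr r) \<partial>M)"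
    using i j assms by (intro integral_mono) (auto intro!: powr_abs_add_le)
  then show "(\<integral>x. \<bar>X x + Y x\<bar> powr r \<partial>M) \<le>
      2 powr r * ((\<integral>x. \<bar>X x\<bar> powr r \<partial>M) + (\<integral>x. \<bar>Y x\<bar> powr r \<partial>M))"
    using int by simp
qed

lemma Lr_space_const:
  assumes "finite_measure M"
  shows "(\<lambda>_. c) \<in> Lr_space (ereal r) M"
  using finite_measure.integrable_const[OF assms] by (simp add: Lr_space_real)

lemma Lr_space_antimono:
  assumes M: "finite_measure M" and r: "0 < r" "r \<le> s" and f: "f \<in> Lr_space (ereal s) M"
  shows "f \<in> Lr_space (ereal r) M"
proof -
  have f' [measurable]: "f \<in> borel_measurable M" and i: "integrable M (\<lambda>x. \<bar>f x\<bar> powr s)"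
    using f by (auto simp: Lr_space_real)
  have j: "integrable M (\<lambda>x. 1 + \<bar>f x\<bar> powr s)"
    using i finite_measure.integrable_const[OF M] by (intro Bochner_Integration.integrable_add)
  have "\<bar>f x\<bar> powr r \<le> 1 + \<bar>f x\<bar> powr s" for x
  proof (cases "\<bar>f x\<bar> \<le> 1")
    case True
    then have "\<bar>f x\<bar> powr r \<le> 1" using r by (intro powr_le1) auto
    then show ?thesis by (simp add: add_increasing2)
  next
    case False
    then have "\<bar>f x\<bar> powr r \<le> \<bar>f x\<bar> powr s" using r by (intro powr_mono) auto
    then show ?thesis by simp
  qed
  then show ?thesis
    unfolding Lr_space_real
    by (intro conjI f' Bochner_Integration.integrable_bound[OF j]) (auto intro!: AE_I2 simp: abs_of_nonneg add_nonneg_nonneg)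
qed

text \<open>
  An \<open>L\<^sup>r\<close> norm of order \<open>O(\<epsilon>\<^sub>n)\<close>, expressed through the \<open>r\<close>-th moment itself. For \<open>r < 1\<close> there
  is no triangle inequality for the norm, whereas moments are subadditive up to the factor
  \<open>2\<^sup>r\<close> for every \<open>r > 0\<close>.
\<close>

definition moment_bigo :: "(nat \<Rightarrow> real) \<Rightarrow> real \<Rightarrow> 'b measure \<Rightarrow> (nat \<Rightarrow> 'b \<Rightarrow> real) \<Rightarrow> bool" where
  "moment_bigo \<epsilon> r M X \<longleftrightarrow> (\<exists>C. \<forall>\<^sub>F n in sequentially.
     X n \<in> Lr_space (ereal r) M \<and> (\<integral>\<omega>. \<bar>X n \<omega>\<bar> powr r \<partial>M) \<le> C * \<epsilon> n powr r)"

lemma moment_bigo_iff: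
  assumes r: "0 < r" and \<epsilon>: "\<And>n. 0 \<le> \<epsilon> n"
  shows "moment_bigo \<epsilon> r M X \<longleftrightarrow> (\<forall>\<^sub>F n in sequentially. X n \<in> Lr_space (ereal r) M) \<and>
    (\<lambda>n. (\<integral>\<omega>. \<bar>X n \<omega>\<bar> powr r \<partial>M) powr (1 / r)) \<in> O(\<epsilon>)" (is "_ \<longleftrightarrow> ?L \<and> ?I \<in> _")
proof
  assume "moment_bigo \<epsilon> r M X"
  then obtain C where C: "\<forall>\<^sub>F n in sequentially. X n \<in> Lr_space (ereal r) M \<and>
      (\<integral>\<omega>. \<bar>X n \<omega>\<bar> powr r \<partial>M) \<le> C * \<epsilon> n powr r"
    by (auto simp: moment_bigo_def)
  have "\<forall>\<^sub>F n in sequentially. norm (?I n) \<le> \<bar>C\<bar> powr (1 / r) * norm (\<epsilon> n)"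
    using C
  proof eventually_elim
    case (elim n)
    have "(\<integral>\<omega>. \<bar>X n \<omega>\<bar> powr r \<partial>M) \<le> \<bar>C\<bar> * \<epsilon> n powr r"
      using elim mult_right_mono[OF abs_ge_self[of C], of "\<epsilon> n powr r"] by auto
    then have "?I n \<le> (\<bar>C\<bar> * \<epsilon> n powr r) powr (1 / r)"
      using r by (intro powr_mono2) auto
    also have "\<dots> = \<bar>C\<bar> powr (1 / r) * \<epsilon> n"
      using r \<epsilon>[of n] by (simp add: powr_mult powr_powr)
    finally show ?case using \<epsilon>[of n] by simp
  qed
  then show "?L \<and> ?I \<in> O(\<epsilon>)"
    using C by (auto intro: bigoI elim: eventually_mono)
next
  assume L: "?L \<and> ?I \<in> O(\<epsilon>)"
  then obtain c where c: "0 < c" "\<forall>\<^sub>F n in sequentially. norm (?I n) \<le> c * norm (\<epsilon> n)"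
    by (auto elim: landau_o.bigE)
  have "\<forall>\<^sub>F n in sequentially. X n \<in> Lr_space (ereal r) M \<and>
      (\<integral>\<omega>. \<bar>X n \<omega>\<bar> powr r \<partial>M) \<le> c powr r * \<epsilon> n powr r"
    using c(2) conjunct1[OF L]
  proof eventually_elim
    case (elim n)
    have "(\<integral>\<omega>. \<bar>X n \<omega>\<bar> powr r \<partial>M) = ?I n powr r"
      using r by (simp add: powr_powr)
    also have "\<dots> \<le> (c * \<epsilon> n) powr r"
      using elim r \<epsilon>[of n] by (intro powr_mono2) auto
    also have "\<dots> = c powr r * \<epsilon> n powr r"
      using c \<epsilon>[of n] by (simp add: powr_mult)
    finally show ?case using elim by simp
  qed
  then show "moment_bigo \<epsilon> r M X"
    unfolding moment_bigo_def by blast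
qed

lemma moment_bigo_add:
  assumes r: "0 < r" and X: "moment_bigo \<epsilon> r M X" and Y: "moment_bigo \<epsilon> r M Y"
    and Z: "\<forall>\<^sub>F n in sequentially. \<forall>\<omega>. Z n \<omega> = X n \<omega> + Y n \<omega>"
  shows "moment_bigo \<epsilon> r M Z"
proof -
  obtain C where C: "\<forall>\<^sub>F n in sequentially. X n \<in> Lr_space (ereal r) M \<and>
      (\<integral>\<omega>. \<bar>X n \<omega>\<bar> powr r \<partial>M) \<le> C * \<epsilon> n powr r"
    using X by (auto simp: moment_bigo_def)
  obtain D where D: "\<forall>\<^sub>F n in sequentially. Y n \<in> Lr_space (ereal r) M \<and>
      (\<integral>\<omega>. \<bar>Y n \<omega>\<bar> powr r \<partial>M) \<le> D * \<epsilon> n powr r"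
    using Y by (auto simp: moment_bigo_def)
  have "\<forall>\<^sub>F n in sequentially. Z n \<in> Lr_space (ereal r) M \<and>
      (\<integral>\<omega>. \<bar>Z n \<omega>\<bar> powr r \<partial>M) \<le> 2 powr r * (C + D) * \<epsilon> n powr r"
    using C D Z
  proof eventually_elim
    case (elim n)
    then have Zn: "Z n = (\<lambda>\<omega>. X n \<omega> + Y n \<omega>)" by auto
    have "(\<integral>\<omega>. \<bar>Z n \<omega>\<bar> powr r \<partial>M) \<le>
        2 powr r * ((\<integral>\<omega>. \<bar>X n \<omega>\<bar> powr r \<partial>M) + (\<integral>\<omega>. \<bar>Y n \<omega>\<bar> powr r \<partial>M))"
      unfolding Zn using elim by (intro Lr_space_add(2)[OF r]) auto
    also have "\<dots> \<le> 2 powr r * (C * \<epsilon> n powr r + D * \<epsilon> n powr r)"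
      using elim by (intro mult_left_mono add_mono) auto
    finally have "(\<integral>\<omega>. \<bar>Z n \<omega>\<bar> powr r \<partial>M) \<le> 2 powr r * (C + D) * \<epsilon> n powr r"
      by (simp add: algebra_simps)
    moreover have "Z n \<in> Lr_space (ereal r) M"
      unfolding Zn using elim by (intro Lr_space_add(1)[OF r]) auto
    ultimately show ?case by simp
  qed
  then show ?thesis
    unfolding moment_bigo_def by blast
qed

lemma moment_bigo_distr:
  assumes T: "T \<in> M \<rightarrow>\<^sub>M N" and X: "\<And>n. X n \<in> borel_measurable N"
  shows "moment_bigo \<epsilon> r (distr M N T) X \<longleftrightarrow> moment_bigo \<epsilon> r M (\<lambda>n \<omega>. X n (T \<omega>))"
proof -
  have [measurable]: "X n \<in> borel_measurable N" for n by fact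
  have "integrable (distr M N T) (\<lambda>\<omega>. \<bar>X n \<omega>\<bar> powr r) \<longleftrightarrow> integrable M (\<lambda>\<omega>. \<bar>X n (T \<omega>)\<bar> powr r)" for n
    by (rule integrable_distr_eq[OF T]) measurable
  moreover have "(\<integral>\<omega>. \<bar>X n \<omega>\<bar> powr r \<partial>distr M N T) = (\<integral>\<omega>. \<bar>X n (T \<omega>)\<bar> powr r \<partial>M)" for n
    by (rule integral_distr[OF T]) measurable
  ultimately show ?thesis
    using T X by (simp add: moment_bigo_def Lr_space_real measurable_compose[OF T])
qed

lemma moment_bigo_const_over_n:
  assumes r: "0 < r" and c: "0 < c" "\<forall>\<^sub>F n in sequentially. c \<le> real n * \<epsilon> n"
    and Z: "Z \<in> Lr_space (ereal r) M"
  shows "moment_bigo \<epsilon> r M (\<lambda>n \<omega>. Z \<omega> / real n)"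
proof -
  let ?C = "(\<integral>\<omega>. \<bar>Z \<omega>\<bar> powr r \<partial>M) / c powr r"
  have "\<forall>\<^sub>F n in sequentially. (\<lambda>\<omega>. Z \<omega> / real n) \<in> Lr_space (ereal r) M \<and>
      (\<integral>\<omega>. \<bar>Z \<omega> / real n\<bar> powr r \<partial>M) \<le> ?C * \<epsilon> n powr r"
    using c(2) eventually_gt_at_top[of 0]
  proof eventually_elim
    case (elim n)
    have eq: "\<bar>Z \<omega> / real n\<bar> powr r = \<bar>Z \<omega>\<bar> powr r / real n powr r" for \<omega>
      by (simp add: powr_divide)
    have "c powr r \<le> (real n * \<epsilon> n) powr r"
      using elim c r by (intro powr_mono2) auto
    moreover have "0 \<le> \<epsilon> n"
      using elim c(1) by (smt (verit) mult_nonneg_nonpos of_nat_0_le_iff)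
    ultimately have "c powr r \<le> real n powr r * \<epsilon> n powr r"
      by (simp add: powr_mult)
    then have "1 / real n powr r \<le> \<epsilon> n powr r / c powr r"
      using c elim by (simp add: field_simps)
    from mult_left_mono[OF this, of "\<integral>\<omega>. \<bar>Z \<omega>\<bar> powr r \<partial>M"]
    have "(\<integral>\<omega>. \<bar>Z \<omega>\<bar> powr r \<partial>M) / real n powr r \<le> ?C * \<epsilon> n powr r"
      by simp
    then show ?case
      unfolding Lr_space_real eq using Z by (auto simp: Lr_space_real)
  qed
  then show ?thesis
    unfolding moment_bigo_def by blast
qed

text \<open>
  The bound on the weight is applied with \<open>b = |X\<^sub>n| / \<epsilon>\<^sub>n\<close>. After this normalisation the
  right-hand side has bounded expectation, and the rate is recovered from the factor
  \<open>\<epsilon>\<^sub>n\<^sup>r\<^sup>'\<close>. This replaces Hoelder's inequality, and treats a bounded weight and an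
  \<open>L\<^sup>s\<close> weight alike.
\<close>

lemma moment_bigo_density:
  assumes c: "\<forall>\<^sub>F n in sequentially. 0 < \<epsilon> n" and r: "0 < r'" "0 < r"
    and w [measurable]: "w \<in> borel_measurable M" and w0: "\<And>\<omega>. 0 \<le> w \<omega>"
    and H: "integrable M H" and bound: "AE \<omega> in M. \<forall>b\<ge>0. w \<omega> * b powr r' \<le> H \<omega> + C * b powr r"
    and C: "0 \<le> C" and X: "moment_bigo \<epsilon> r M X"
  shows "moment_bigo \<epsilon> r' (density M (\<lambda>\<omega>. ennreal (w \<omega>))) X"
proof -
  obtain D where D: "\<forall>\<^sub>F n in sequentially. X n \<in> Lr_space (ereal r) M \<and>
      (\<integral>\<omega>. \<bar>X n \<omega>\<bar> powr r \<partial>M) \<le> D * \<epsilon> n powr r"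
    using X by (auto simp: moment_bigo_def)
  let ?N = "density M (\<lambda>\<omega>. ennreal (w \<omega>))"
  have "\<forall>\<^sub>F n in sequentially. X n \<in> Lr_space (ereal r') ?N \<and>
      (\<integral>\<omega>. \<bar>X n \<omega>\<bar> powr r' \<partial>?N) \<le> ((\<integral>\<omega>. H \<omega> \<partial>M) + C * D) * \<epsilon> n powr r'"
    using c D
  proof eventually_elim
    case (elim n)
    have [measurable]: "X n \<in> borel_measurable M" and i: "integrable M (\<lambda>\<omega>. \<bar>X n \<omega>\<bar> powr r)"
      using elim by (auto simp: Lr_space_real)
    \<comment> \<open>The bound on the weight at \<open>b = \<bar>X\<^sub>n\<bar> / \<epsilon>\<^sub>n\<close>, multiplied by \<open>\<epsilon>\<^sub>n\<^sup>r\<^sup>'\<close>.\<close>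
    let ?U = "\<lambda>\<omega>. \<epsilon> n powr r' * (H \<omega> + C * (\<bar>X n \<omega>\<bar> powr r / \<epsilon> n powr r))"
    have iU: "integrable M ?U"
      using H i by auto
    have le: "AE \<omega> in M. w \<omega> * \<bar>X n \<omega>\<bar> powr r' \<le> ?U \<omega>"
      using bound
    proof eventually_elim
      case (elim \<omega>)
      have "w \<omega> * (\<bar>X n \<omega>\<bar> / \<epsilon> n) powr r' \<le> H \<omega> + C * (\<bar>X n \<omega>\<bar> / \<epsilon> n) powr r"
        using elim \<open>0 < \<epsilon> n\<close> by (intro elim[rule_format]) auto
      then have "\<epsilon> n powr r' * (w \<omega> * (\<bar>X n \<omega>\<bar> powr r' / \<epsilon> n powr r')) \<le> ?U \<omega>"
        using \<open>0 < \<epsilon> n\<close> by (intro mult_left_mono) (auto simp: powr_divide)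
      then show ?case
        using \<open>0 < \<epsilon> n\<close> by simp
    qed
    have j: "integrable M (\<lambda>\<omega>. w \<omega> * \<bar>X n \<omega>\<bar> powr r')"
      by (rule Bochner_Integration.integrable_bound[OF iU]) (use le w0 in \<open>auto elim!: eventually_mono\<close>)
    have "(\<integral>\<omega>. \<bar>X n \<omega>\<bar> powr r' \<partial>?N) = (\<integral>\<omega>. w \<omega> * \<bar>X n \<omega>\<bar> powr r' \<partial>M)"
      using w0 by (subst integral_density) auto
    also have "\<dots> \<le> (\<integral>\<omega>. ?U \<omega> \<partial>M)"
      by (rule integral_mono_AE[OF j iU le])
    also have "\<dots> = \<epsilon> n powr r' * ((\<integral>\<omega>. H \<omega> \<partial>M) + C * ((\<integral>\<omega>. \<bar>X n \<omega>\<bar> powr r \<partial>M) / \<epsilon> n powr r))"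
      using H i by simp
    also have "\<dots> \<le> \<epsilon> n powr r' * ((\<integral>\<omega>. H \<omega> \<partial>M) + C * D)"
      using elim C by (intro mult_left_mono add_left_mono) (auto simp: divide_le_eq)
    finally have "(\<integral>\<omega>. \<bar>X n \<omega>\<bar> powr r' \<partial>?N) \<le> ((\<integral>\<omega>. H \<omega> \<partial>M) + C * D) * \<epsilon> n powr r'"
      by (simp add: mult.commute)
    moreover have "integrable ?N (\<lambda>\<omega>. \<bar>X n \<omega>\<bar> powr r')"
      using j w0 by (subst integrable_density) auto
    ultimately show ?case
      by (simp add: Lr_space_real)
  qed
  then show ?thesis
    unfolding moment_bigo_def by blast
qed

text \<open>
  Young's inequality for the conjugate exponents \<open>r/(r - r')\<close> and \<open>r/r'\<close>, with constants 1:
  the left-hand side is below the second or the first term according to whether \<open>a\<close> is below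
  \<open>b\<^sup>r\<^sup>-\<^sup>r\<^sup>'\<close> or not.
\<close>

lemma mult_powr_le_conjugate:
  fixes a b :: real
  assumes r: "0 < r'" "r' < r" and a: "0 \<le> a" and b: "0 \<le> b"
  shows "a * b powr r' \<le> a powr (r / (r - r')) + b powr r"
proof (cases "a \<le> b powr (r - r')")
  case True
  then have "a * b powr r' \<le> b powr (r - r') * b powr r'"
    by (intro mult_right_mono) auto
  also have "\<dots> = b powr r"
    by (simp add: powr_add[symmetric])
  finally show ?thesis by (simp add: add_increasing)
next
  case False
  then have "0 < a" using powr_ge_zero[of b "r - r'"] by linarith
  have "b powr r' = (b powr (r - r')) powr (r' / (r - r'))"
    using r by (simp add: powr_powr)
  also have "\<dots> \<le> a powr (r' / (r - r'))"
    using False r by (intro powr_mono2) auto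
  finally have "a * b powr r' \<le> a powr 1 * a powr (r' / (r - r'))"
    using a by (simp add: mult_left_mono)
  also have "\<dots> = a powr (1 + r' / (r - r'))"
    by (simp only: powr_add)
  also have "1 + r' / (r - r') = r / (r - r')"
    using r by (simp add: field_simps)
  finally show ?thesis by (simp add: add_increasing2)
qed

lemma Lr_space_conjugate_bound:
  assumes r: "0 < r'" "r' \<le> r" and w0: "\<And>z. 0 \<le> w z"
    and w: "w \<in> Lr_space (if r' = r then \<infinity> else ereal (r / (r - r'))) M"
  obtains H C where "integrable M H" "0 \<le> C" "AE z in M. \<forall>b\<ge>0. w z * b powr r' \<le> H z + C * b powr r"
proof (cases "r' = r")
  case True
  then obtain C where C: "AE z in M. \<bar>w z\<bar> \<le> C"
    using w by (auto simp: Lr_space_def)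
  have "AE z in M. \<forall>b\<ge>0. w z * b powr r' \<le> 0 + max 0 C * b powr r"
    using C
  proof eventually_elim
    case (elim z)
    then show ?case
      unfolding True add_0 by (intro allI impI mult_right_mono) auto
  qed
  then show ?thesis
    by (intro that[of "\<lambda>_. 0" "max 0 C"]) auto
next
  case False
  then have "integrable M (\<lambda>z. \<bar>w z\<bar> powr (r / (r - r')))"
    using w by (simp add: Lr_space_real)
  then show ?thesis
    using r False w0 by (intro that[of "\<lambda>z. \<bar>w z\<bar> powr (r / (r - r'))" 1])
      (auto intro!: AE_I2 mult_powr_le_conjugate)
qed

lemma liminf_pos_imp_eventually_ge:
  assumes "0 < liminf (\<lambda>n. ereal (a n))"
  obtains c where "0 < c" "\<forall>\<^sub>F n in sequentially. c \<le> a n"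
proof -
  obtain x where x: "0 < ereal x" "ereal x < liminf (\<lambda>n. ereal (a n))"
    using ereal_dense2[OF assms] by auto
  then have "\<forall>\<^sub>F n in sequentially. x \<le> a n"
    by (auto dest!: less_LiminfD elim: eventually_mono)
  then show ?thesis
    using x by (intro that[of x]) auto
qed

lemma const_over_n_bigo:
  assumes c: "0 < c" "\<forall>\<^sub>F n in sequentially. c \<le> real n * \<epsilon> n"
  shows "(\<lambda>n. z / real n) \<in> O(\<epsilon>)"
proof (rule bigoI)
  show "\<forall>\<^sub>F n in sequentially. norm (z / real n) \<le> \<bar>z\<bar> / c * norm (\<epsilon> n)"
    using c(2) eventually_gt_at_top[of 0]
  proof eventually_elim
    case (elim n)
    have "c \<le> real n * \<bar>\<epsilon> n\<bar>"
      using elim(1) by (rule order_trans) (simp add: mult_left_mono)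
    from mult_left_mono[OF this, of "\<bar>z\<bar>"] show ?case
      using c elim(2) by (simp add: field_simps)
  qed
qed

section \<open>Transfer of the error rates\<close>

text \<open>
  The part of the error that depends on the future of \<open>Y\<^sub>0\<close> only, read as a function of the
  shifted path. It sums \<open>n - 1\<close> terms but is divided by \<open>n\<close>. The error at time \<open>n - 1\<close> would
  not do instead: it is comparable with \<open>\<epsilon>\<^sub>n\<^sub>-\<^sub>1\<close>, and nothing relates \<open>\<epsilon>\<^sub>n\<^sub>-\<^sub>1\<close> to \<open>\<epsilon>\<^sub>n\<close>.
\<close>

definition delayed_error :: "'a measure \<Rightarrow> ('a \<Rightarrow> real) \<Rightarrow> nat \<Rightarrow> (nat \<Rightarrow> 'a) \<Rightarrow> real" where
  "delayed_error \<nu> f n \<omega> = (\<Sum>k<n - 1. f (\<omega> k) - (\<integral>x. f x \<partial>\<nu>)) / real n"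

lemma ergodic_error_eq_delayed_error:
  assumes "0 < n"
  shows "ergodic_error \<nu> f n \<omega> =
    (f (\<omega> 0) - (\<integral>x. f x \<partial>\<nu>)) / real n + delayed_error \<nu> f n (\<lambda>k. \<omega> (Suc k))"
proof -
  obtain m where n: "n = Suc m"
    using assms gr0_implies_Suc by blast
  have "ergodic_error \<nu> f n \<omega> = (\<Sum>k<n. f (\<omega> k) - (\<integral>x. f x \<partial>\<nu>)) / real n"
    using assms by (simp add: ergodic_error_def sum_subtractf diff_divide_distrib)
  also have "(\<Sum>k<n. f (\<omega> k) - (\<integral>x. f x \<partial>\<nu>)) = (f (\<omega> 0) - (\<integral>x. f x \<partial>\<nu>)) +
      (\<Sum>k<n - 1. f (\<omega> (Suc k)) - (\<integral>x. f x \<partial>\<nu>))"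
    unfolding n by (subst sum.lessThan_Suc_shift) simp
  finally show ?thesis
    by (simp add: delayed_error_def add_divide_distrib)
qed

lemma measurable_delayed_error:
  assumes [measurable]: "f \<in> borel_measurable borel"
  shows "delayed_error \<nu> f n \<in> borel_measurable paths"
  unfolding delayed_error_def[abs_def] by measurable

text \<open>
  The constant in the \<open>O\<close> can be taken to be a natural number, which leaves
  countable quantifiers only.
\<close>

lemma bigo_set_measurable:
  fixes X :: "nat \<Rightarrow> 'b \<Rightarrow> real"
  assumes [measurable]: "\<And>n. X n \<in> borel_measurable M"
  shows "{\<omega> \<in> space M. (\<lambda>n. X n \<omega>) \<in> O(\<epsilon>)} \<in> sets M"
proof -
  have "(\<lambda>n. X n \<omega>) \<in> O(\<epsilon>) \<longleftrightarrow> (\<exists>m N. \<forall>n\<ge>N. \<bar>X n \<omega>\<bar> \<le> real m * \<bar>\<epsilon> n\<bar>)" for \<omega>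
  proof
    assume "(\<lambda>n. X n \<omega>) \<in> O(\<epsilon>)"
    then obtain c where "\<forall>\<^sub>F n in sequentially. norm (X n \<omega>) \<le> c * norm (\<epsilon> n)"
      by (auto elim: landau_o.bigE)
    then obtain N where N: "\<bar>X n \<omega>\<bar> \<le> c * \<bar>\<epsilon> n\<bar>" if "n \<ge> N" for n
      by (auto simp: eventually_sequentially)
    obtain m where "c \<le> real m"
      using real_arch_simple by blast
    then have "\<bar>X n \<omega>\<bar> \<le> real m * \<bar>\<epsilon> n\<bar>" if "n \<ge> N" for n
      using N[OF that] mult_right_mono[of c "real m" "\<bar>\<epsilon> n\<bar>"] by simp
    then show "\<exists>m N. \<forall>n\<ge>N. \<bar>X n \<omega>\<bar> \<le> real m * \<bar>\<epsilon> n\<bar>" by blast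
  next
    assume "\<exists>m N. \<forall>n\<ge>N. \<bar>X n \<omega>\<bar> \<le> real m * \<bar>\<epsilon> n\<bar>"
    then obtain m where "\<forall>\<^sub>F n in sequentially. norm (X n \<omega>) \<le> real m * norm (\<epsilon> n)"
      by (auto simp: eventually_sequentially)
    then show "(\<lambda>n. X n \<omega>) \<in> O(\<epsilon>)"
      by (rule bigoI)
  qed
  then show ?thesis by simp
qed

context
  fixes P :: "'a::t1_space \<Rightarrow> 'a measure" and \<nu> :: "'a measure" and \<epsilon> :: "nat \<Rightarrow> real" and c :: real
  assumes P: "transition_kernel P" and inv: "invariant_distribution P \<nu>"
    and \<epsilon>: "0 < c" "\<forall>\<^sub>F n in sequentially. c \<le> real n * \<epsilon> n"
begin

lemma invariantD: "prob_space \<nu>" "sets \<nu> = sets borel" "\<nu> \<bind> P = \<nu>"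
  using inv by (auto simp: invariant_distribution_def)

lemma shift_measurable_chain_law:
  assumes "prob_space \<mu>" "sets \<mu> = sets borel"
  shows "(\<lambda>\<omega> n. \<omega> (Suc n)) \<in> chain_law P \<mu> \<rightarrow>\<^sub>M paths"
  by (simp add: measurable_shift measurable_cong_sets[OF sets_chain_law[OF P assms] refl])

text \<open>
  On the shifted path the delayed error is the error minus a term of order \<open>1/n\<close>, hence
  \<open>O(\<epsilon>\<^sub>n)\<close>; by stationarity the shifted path has the same law as the path.
\<close>

lemma AE_delayed_error_stationary:
  assumes f: "f \<in> borel_measurable borel"
    and AE: "AE \<omega> in chain_law P \<nu>. (\<lambda>n. ergodic_error \<nu> f n \<omega>) \<in> O(\<epsilon>)"
  shows "AE \<omega> in chain_law P \<nu>. (\<lambda>n. delayed_error \<nu> f n \<omega>) \<in> O(\<epsilon>)"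
proof -
  have "AE \<omega> in chain_law P \<nu>. (\<lambda>n. delayed_error \<nu> f n (\<lambda>k. \<omega> (Suc k))) \<in> O(\<epsilon>)"
    using AE
  proof eventually_elim
    case (elim \<omega>)
    then have "(\<lambda>n. ergodic_error \<nu> f n \<omega> - (f (\<omega> 0) - (\<integral>x. f x \<partial>\<nu>)) / real n) \<in> O(\<epsilon>)"
      by (rule sum_in_bigo(2)) (rule const_over_n_bigo[OF \<epsilon>])
    moreover have "\<forall>\<^sub>F n in sequentially. ergodic_error \<nu> f n \<omega> - (f (\<omega> 0) - (\<integral>x. f x \<partial>\<nu>)) / real n =
        delayed_error \<nu> f n (\<lambda>k. \<omega> (Suc k))"
      using eventually_gt_at_top[of 0] by eventually_elim (simp add: ergodic_error_eq_delayed_error)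
    ultimately show ?case
      by (simp cong: landau_o.big.in_cong)
  qed
  moreover have "{\<omega> \<in> space paths. (\<lambda>n. delayed_error \<nu> f n \<omega>) \<in> O(\<epsilon>)} \<in> sets paths"
    by (rule bigo_set_measurable) (rule measurable_delayed_error[OF f])
  ultimately have "AE \<omega> in distr (chain_law P \<nu>) paths (\<lambda>\<omega> n. \<omega> (Suc n)). (\<lambda>n. delayed_error \<nu> f n \<omega>) \<in> O(\<epsilon>)"
    by (subst AE_distr_iff[OF shift_measurable_chain_law[OF invariantD(1,2)]])
  then show ?thesis
    unfolding distr_chain_law_shift[OF P invariantD(1,2)] invariantD(3) .
qed

text \<open>
  The reason is the same as for the almost sure rate: subtract a term of order \<open>1/n\<close>, whose
  moments are finite because \<open>Y\<^sub>0\<close> has law \<open>\<nu>\<close>, and undo the shift by stationarity.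
\<close>

lemma moment_bigo_delayed_error_stationary:
  assumes r: "0 < r" and f: "f \<in> borel_measurable borel" "f \<in> Lr_space (ereal r) \<nu>"
    and m: "moment_bigo \<epsilon> r (chain_law P \<nu>) (ergodic_error \<nu> f)"
  shows "moment_bigo \<epsilon> r (chain_law P \<nu>) (delayed_error \<nu> f)"
proof -
  note cong = measurable_cong_sets[OF sets_chain_law[OF P invariantD(1,2)] refl]
  let ?d = "\<lambda>x. - (f x - (\<integral>x. f x \<partial>\<nu>))"
  have [measurable]: "f \<in> borel_measurable borel" by fact
  have "?d \<in> Lr_space (ereal r) \<nu>"
    using Lr_space_add(1)[OF r f(2) Lr_space_const[OF prob_space.finite_measure[OF invariantD(1)]], of "- (\<integral>x. f x \<partial>\<nu>)"]
    by (auto simp: Lr_space_real abs_minus_commute dest: borel_measurable_uminus)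
  then have "integrable (distr (chain_law P \<nu>) borel (\<lambda>\<omega>. \<omega> 0)) (\<lambda>x. \<bar>?d x\<bar> powr r)"
    by (simp add: distr_chain_law_0[OF P invariantD(1,2)] Lr_space_real)
  then have "integrable (chain_law P \<nu>) (\<lambda>\<omega>. \<bar>?d (\<omega> 0)\<bar> powr r)"
    by (subst (asm) integrable_distr_eq) (simp_all add: cong)
  then have "(\<lambda>\<omega>. ?d (\<omega> 0)) \<in> Lr_space (ereal r) (chain_law P \<nu>)"
    by (simp add: Lr_space_real cong)
  from moment_bigo_const_over_n[OF r \<epsilon> this]
  have "moment_bigo \<epsilon> r (chain_law P \<nu>) (\<lambda>n \<omega>. delayed_error \<nu> f n (\<lambda>k. \<omega> (Suc k)))"
    by (rule moment_bigo_add[OF r m])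
       (use eventually_gt_at_top[of 0] in \<open>eventually_elim, simp add: ergodic_error_eq_delayed_error field_simps\<close>)
  then have "moment_bigo \<epsilon> r (distr (chain_law P \<nu>) paths (\<lambda>\<omega> n. \<omega> (Suc n))) (delayed_error \<nu> f)"
    by (subst moment_bigo_distr[OF shift_measurable_chain_law[OF invariantD(1,2)] measurable_delayed_error[OF f(1)]])
  then show ?thesis
    by (simp add: distr_chain_law_shift[OF P invariantD(1,2)] invariantD(3))
qed

lemma prob_space_return_borel: "prob_space (return borel (y :: 'a))" "sets (return borel y) = sets borel"
  by (simp_all add: prob_space_return)

lemma distr_chain_law_return_shift:
  "distr (chain_law P (return borel y)) paths (\<lambda>\<omega> n. \<omega> (Suc n)) = chain_law P (P y)"
  by (simp add: distr_chain_law_shift[OF P prob_space_return_borel] bind_return[OF kernel_measurable[OF P]])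

lemma AE_chain_law_return_0: "AE \<omega> in chain_law P (return borel y). \<omega> 0 = y"
proof -
  have "AE x in return borel y. x = y"
    by (subst AE_return) (auto simp: pred_def)
  then have "AE x in distr (chain_law P (return borel y)) borel (\<lambda>\<omega>. \<omega> 0). x = y"
    unfolding distr_chain_law_0[OF P prob_space_return_borel] .
  then show ?thesis
    by (rule AE_distrD[rotated])
      (simp add: measurable_cong_sets[OF sets_chain_law[OF P prob_space_return_borel] refl])
qed

text \<open>
  Under the chain started at \<open>y\<close>, the shifted path has density \<open>g(Y\<^sub>0)\<close> with respect to the
  stationary chain. So the almost sure rate of the delayed error carries over by absolute
  continuity, and the moment rate by the integrability or boundedness of \<open>g\<close>. The remaining term is
  \<open>(f(y) - \<integral> f d\<nu>) / n\<close>.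
\<close>

lemma rate_class_return:
  assumes r: "0 < r'" "r' \<le> r" and \<epsilon>0: "\<And>n. 0 \<le> \<epsilon> n"
    and g [measurable]: "g \<in> borel_measurable borel" and g0: "\<And>z. 0 \<le> g z"
    and Py: "P y = density \<nu> (\<lambda>z. ennreal (g z))"
    and gL: "g \<in> Lr_space (if r' = r then \<infinity> else ereal (r / (r - r'))) \<nu>"
    and fV: "f \<in> rate_class \<epsilon> r \<nu> (chain_law P \<nu>)"
  shows "f \<in> rate_class \<epsilon> r' \<nu> (chain_law P (return borel y))"
proof -
  let ?Q = "chain_law P (return borel y)" and ?Q\<nu> = "chain_law P \<nu>"
  note ret = prob_space_return_borel[of y]
  note cong = measurable_cong_sets[OF sets_chain_law[OF P ret] refl]
  note cong\<nu> = measurable_cong_sets[OF sets_chain_law[OF P invariantD(1,2)] refl]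
  have r0: "0 < r" using r by simp
  have f [measurable]: "f \<in> borel_measurable borel" and fr: "f \<in> Lr_space (ereal r) \<nu>"
    and fi: "integrable \<nu> f"
    and AE: "AE \<omega> in ?Q\<nu>. (\<lambda>n. ergodic_error \<nu> f n \<omega>) \<in> O(\<epsilon>)"
    and mom: "moment_bigo \<epsilon> r ?Q\<nu> (ergodic_error \<nu> f)"
    using fV by (auto simp: rate_class_def moment_bigo_iff[OF r0 \<epsilon>0])
  have fr': "f \<in> Lr_space (ereal r') \<nu>"
    by (rule Lr_space_antimono[OF prob_space.finite_measure[OF invariantD(1)] r fr])
  have PyP: "prob_space (P y)" "sets (P y) = sets borel"
    by (rule prob_space_kernel[OF P], rule sets_transition_kernel[OF P])
  have law: "chain_law P (P y) = density ?Q\<nu> (\<lambda>\<omega>. ennreal (g (\<omega> 0)))"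
    using chain_law_density[OF P invariantD(1,2), of "\<lambda>z. ennreal (g z)"] PyP(1) by (simp add: Py)

  have "absolutely_continuous \<nu> (P y)"
    unfolding Py using g by (intro absolutely_continuousI_density) (simp add: measurable_cong_sets[OF invariantD(2) refl])
  from AE_chain_law_absolutely_continuous[OF P invariantD(1,2) PyP this AE_delayed_error_stationary[OF f AE]]
  have "AE \<omega> in distr ?Q paths (\<lambda>\<omega> n. \<omega> (Suc n)). (\<lambda>n. delayed_error \<nu> f n \<omega>) \<in> O(\<epsilon>)"
    unfolding distr_chain_law_return_shift .
  from AE_distrD[OF shift_measurable_chain_law[OF ret] this]
  have AEy: "AE \<omega> in ?Q. (\<lambda>n. ergodic_error \<nu> f n \<omega>) \<in> O(\<epsilon>)"
  proof eventually_elim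
    case (elim \<omega>)
    have "(\<lambda>n. (f (\<omega> 0) - (\<integral>x. f x \<partial>\<nu>)) / real n + delayed_error \<nu> f n (\<lambda>k. \<omega> (Suc k))) \<in> O(\<epsilon>)"
      by (rule sum_in_bigo(1)[OF const_over_n_bigo[OF \<epsilon>] elim])
    moreover have "\<forall>\<^sub>F n in sequentially. (f (\<omega> 0) - (\<integral>x. f x \<partial>\<nu>)) / real n +
        delayed_error \<nu> f n (\<lambda>k. \<omega> (Suc k)) = ergodic_error \<nu> f n \<omega>"
      using eventually_gt_at_top[of 0] by eventually_elim (simp add: ergodic_error_eq_delayed_error)
    ultimately show ?case
      by (simp cong: landau_o.big.in_cong)
  qed

  obtain H C where H: "integrable \<nu> H" and C: "0 \<le> C"
    and HC: "AE z in \<nu>. \<forall>b\<ge>0. g z * b powr r' \<le> H z + C * b powr r"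
    by (rule Lr_space_conjugate_bound[OF r g0 gL])
  have Y0: "(\<lambda>\<omega>. \<omega> 0) \<in> ?Q\<nu> \<rightarrow>\<^sub>M borel"
    by (simp add: cong\<nu>)
  have "moment_bigo \<epsilon> r' (density ?Q\<nu> (\<lambda>\<omega>. ennreal (g (\<omega> 0)))) (delayed_error \<nu> f)"
  proof (rule moment_bigo_density[OF _ r(1) r0 _ _ _ _ C moment_bigo_delayed_error_stationary[OF r0 f fr mom]])
    show "\<forall>\<^sub>F n in sequentially. 0 < \<epsilon> n"
      using \<epsilon>(2) by eventually_elim (use \<epsilon>(1) in \<open>auto simp: zero_less_mult_iff dest: less_le_trans\<close>)
    show "integrable ?Q\<nu> (\<lambda>\<omega>. H (\<omega> 0))"
      using H by (intro integrable_distr[OF Y0]) (simp add: distr_chain_law_0[OF P invariantD(1,2)])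
    show "AE \<omega> in ?Q\<nu>. \<forall>b\<ge>0. g (\<omega> 0) * b powr r' \<le> H (\<omega> 0) + C * b powr r"
      by (rule AE_distrD[OF Y0]) (unfold distr_chain_law_0[OF P invariantD(1,2)], rule HC)
    show "(\<lambda>\<omega>. g (\<omega> 0)) \<in> borel_measurable ?Q\<nu>"
      by (simp add: cong\<nu>)
  qed (simp add: g0)
  then have "moment_bigo \<epsilon> r' (distr ?Q paths (\<lambda>\<omega> n. \<omega> (Suc n))) (delayed_error \<nu> f)"
    by (simp add: distr_chain_law_return_shift law)
  then have m1: "moment_bigo \<epsilon> r' ?Q (\<lambda>n \<omega>. delayed_error \<nu> f n (\<lambda>k. \<omega> (Suc k)))"
    by (subst (asm) moment_bigo_distr[OF shift_measurable_chain_law[OF ret] measurable_delayed_error[OF f]])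
  let ?d = "\<lambda>x. f x - (\<integral>x. f x \<partial>\<nu>)"
  interpret Q: prob_space ?Q by (rule prob_space_chain_law[OF P ret])
  have "integrable ?Q (\<lambda>\<omega>. \<bar>?d (\<omega> 0)\<bar> powr r')"
    using AE_chain_law_return_0[of y]
    by (intro Q.integrable_const_bound[where B="\<bar>?d y\<bar> powr r'"]) (auto simp: cong elim!: eventually_mono)
  then have "(\<lambda>\<omega>. ?d (\<omega> 0)) \<in> Lr_space (ereal r') ?Q"
    by (simp add: Lr_space_real cong)
  from moment_bigo_const_over_n[OF r(1) \<epsilon> this] m1
  have "moment_bigo \<epsilon> r' ?Q (ergodic_error \<nu> f)"
    by (rule moment_bigo_add[OF r(1)])
       (use eventually_gt_at_top[of 0] in \<open>eventually_elim, simp add: ergodic_error_eq_delayed_error\<close>)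
  then show ?thesis
    using f fr' fi AEy by (simp add: rate_class_def moment_bigo_iff[OF r(1) \<epsilon>0])
qed

end

theorem proposition4p3:
  fixes P :: "real ^ 'q \<Rightarrow> (real ^ 'q) measure"
    and \<nu> :: "(real ^ 'q) measure"
    and g :: "real ^ 'q \<Rightarrow> real ^ 'q \<Rightarrow> real"
    and p p' :: real
  assumes "1 \<le> p" and "0 < p'" and "p' \<le> p"
    and "transition_kernel P"
    and "prob_space \<nu>" and "sets \<nu> = sets borel"
    and "ergodic_chain P \<nu>"
    and "\<And>y. g y \<in> borel_measurable borel"
    and "\<And>y z. 0 \<le> g y z"
    and "\<And>y. P y = density \<nu> (\<lambda>z. ennreal (g y z))"
    and "AE z in \<nu>. \<forall>y. 0 < g y z"
  shows "invariant_distribution P \<nu> \<and>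
    (\<forall>\<mu>. invariant_distribution P \<mu> \<longrightarrow> \<mu> = \<nu>) \<and>
    (\<forall>\<epsilon> :: nat \<Rightarrow> real. (\<forall>n. 0 \<le> \<epsilon> n) \<longrightarrow> \<epsilon> \<longlonglongrightarrow> 0 \<longrightarrow>
       0 < liminf (\<lambda>n. ereal (real n * \<epsilon> n)) \<longrightarrow>
       (\<forall>y. g y \<in> Lr_space (if p' = p then \<infinity> else ereal (p / (p - p'))) \<nu> \<longrightarrow>
          rate_class \<epsilon> p \<nu> (chain_law P \<nu>)
            \<subseteq> rate_class \<epsilon> p' \<nu> (chain_law P (return borel y))))"
proof (intro conjI allI impI subsetI)
  have ac: "absolutely_continuous \<nu> (P y)" for y
    unfolding assms(10) using assms(8)[of y]
    by (intro absolutely_continuousI_density) (simp add: measurable_cong_sets[OF assms(6) refl])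
  show inv: "invariant_distribution P \<nu>"
    by (rule invariant_distribution_ergodic[OF assms(4-7)])
  show "\<mu> = \<nu>" if "invariant_distribution P \<mu>" for \<mu>
    by (rule invariant_distribution_unique[OF assms(4-7) ac that])
  fix \<epsilon> :: "nat \<Rightarrow> real" and y f
  assume \<epsilon>: "\<forall>n. 0 \<le> \<epsilon> n" "0 < liminf (\<lambda>n. ereal (real n * \<epsilon> n))"
    and gL: "g y \<in> Lr_space (if p' = p then \<infinity> else ereal (p / (p - p'))) \<nu>"
    and f: "f \<in> rate_class \<epsilon> p \<nu> (chain_law P \<nu>)"
  obtain c where c: "0 < c" "\<forall>\<^sub>F n in sequentially. c \<le> real n * \<epsilon> n"
    by (rule liminf_pos_imp_eventually_ge[OF \<epsilon>(2)])
  show "f \<in> rate_class \<epsilon> p' \<nu> (chain_law P (return borel y))"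
    by (rule rate_class_return[OF assms(4) inv c assms(2,3) \<epsilon>(1)[rule_format] assms(8) assms(9) assms(10) gL f])
qed

end
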